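(* Let $(\beta,\Psi,p,\mathrm d\mu)\in\Lambda$ and let $t\in(0,T)$ be such that $[\hat u_t]$ makes sense. Then $$\text{(i)}\quad [\hat u_t]\,[H_u(t)]=0,\qquad\qquad \text{(ii)}\quad [\mu_t]\left[\frac{\mathrm d}{\mathrm dt}g(\hat x_t)\right]=0 .$$
   Context: Setting. $T>0$; $f_0,f_1:\mathbb R^n\to\mathbb R^n$ are $C^2$ and Lipschitz continuous; $\phi:\mathbb R^n\times\mathbb R^n\to\mathbb R$, $g:\mathbb R^n\to\mathbb R$ and $\Phi:\mathbb R^n\times\mathbb R^n\to\mathbb R^{n_1+n_2}$ are $C^2$; $u_{\min}\in\mathbb R\cup\{-\infty\}$, $u_{\max}\in\mathbb R\cup\{+\infty\}$. Set $f(u,x):=f_0(x)+uf_1(x)$ and $K_\Phi:=\{0\}_{\mathbb R^{n_1}}\times\mathbb R^{n_2}_-$. Problem (P): minimize $\phi(x_0,x_T)$ over $(u,x)\in L^\infty(0,T)\times W^{1,\infty}(0,T)^n$ subject to $\dot x_t=f_0(x_t)+u_tf_1(x_t)$ for a.a. $t$; $\Phi(x_0,x_T)\in K_\Phi$; $u_{\min}\le u_t\le u_{\max}$ for a.a. $t$; $g(x_t)\le 0$ for all $t\in[0,T]$. A pair satisfying all constraints is a feasible trajectory; $(\hat u,\hat x)$ is a fixed feasible trajectory. Multipliers. $\mathcal M$ is the space of finite Radon measures on $[0,T]$; every $\mathrm d\mu\in\mathcal M$ is identified with the derivative of a function $\mu$ of bounded variation with $\mu_T=0$. Let $\ell^{\beta,\Psi}:=\beta\phi+\Psi\Phi$.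 $\Lambda=\Lambda(\hat u,\hat x)$ is the set of $(\beta,\Psi,p,\mathrm d\mu)\in\mathbb R_+\times\mathbb R^{(n_1+n_2)*}\times BV(0,T)^{n*}\times\mathcal M$ with $(\beta,\Psi,\mathrm d\mu)\ne0$ such that: $\Psi_i\ge0$ and $\Psi_i\Phi_i(\hat x_0,\hat x_T)=0$ for $i=n_1+1,\dots,n_1+n_2$; $\mathrm d\mu\ge0$ and $\int_0^Tg(\hat x_t)\,\mathrm d\mu_t=0$; $-\mathrm dp_t=p_tf_x(\hat u_t,\hat x_t)\,\mathrm dt+g'(\hat x_t)\,\mathrm d\mu_t$ on $[0,T]$ with $(-p_0,p_T)=D\ell^{\beta,\Psi}(\hat x_0,\hat x_T)$; and for a.a. $t$: $\hat u_t=u_{\min}$ if $u_{\min}>-\infty$ and $p_tf_1(\hat x_t)>0$, $\hat u_t=u_{\max}$ if $u_{\max}<+\infty$ and $p_tf_1(\hat x_t)<0$, $p_tf_1(\hat x_t)=0$ if $u_{\min}<\hat u_t<u_{\max}$. Notation. $H(u,x,p):=p(f_0(x)+uf_1(x))$, so $H_u(t)=p_tf_1(\hat x_t)$. The jump of a function $h$ at $t\in(0,T)$ is $[h_t]:=h(t+)-h(t-)$ when both one-sided limits exist and are finite. For a function defined only almost everywhere (such as $\hat u$ or $\frac{\mathrm d}{\mathrm dt}g(\hat x_t)=g'(\hat x_t)f(\hat u_t,\hat x_t)$), the jump at $t$ is that of a representative having left and right limits at $t$, provided such a representative exists; "$[\hat u_t]$ makes sense" means that it does.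
   Formalization: In Λ, for a.a. t, p_t f_1(x̂_t) ≤ 0 is also required if u_min = −∞ and p_t f_1(x̂_t) ≥ 0 if u_max = +∞ (as minimality of H demands); with the three literal clauses alone the claim fails for an infinite bound. *)

theory Defs
  imports "HOL-Analysis.Analysis"
begin

definition C2 :: "('a::real_normed_vector \<Rightarrow> 'b::real_normed_vector) \<Rightarrow> bool" where
  "C2 h \<longleftrightarrow> (\<exists>(h' :: 'a \<Rightarrow> 'a \<Rightarrow>\<^sub>L 'b) (h'' :: 'a \<Rightarrow> 'a \<Rightarrow>\<^sub>L ('a \<Rightarrow>\<^sub>L 'b)).
     (\<forall>y. (h has_derivative blinfun_apply (h' y)) (at y)) \<and>
     (\<forall>y. (h' has_derivative blinfun_apply (h'' y)) (at y)) \<and>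
     continuous_on UNIV h'')"

definition Linf :: "real \<Rightarrow> (real \<Rightarrow> 'a::euclidean_space) set" where
  "Linf T = {u. u \<in> borel_measurable (lebesgue_on {0<..<T}) \<and>
                (\<exists>C. AE s in lebesgue_on {0<..<T}. norm (u s) \<le> C)}"

definition test_function :: "real \<Rightarrow> (real \<Rightarrow> real) \<Rightarrow> (real \<Rightarrow> real) \<Rightarrow> bool" where
  "test_function T \<psi> \<psi>' \<longleftrightarrow>
     (\<forall>s. (\<psi> has_real_derivative \<psi>' s) (at s)) \<and> continuous_on UNIV \<psi>' \<and>
     (\<exists>a b. 0 < a \<and> b < T \<and> (\<forall>s. s \<notin> {a..b} \<longrightarrow> \<psi> s = 0))"

definition weak_derivative :: "real \<Rightarrow> (real \<Rightarrow> 'a::euclidean_space) \<Rightarrow> (real \<Rightarrow> 'a) \<Rightarrow> bool" where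
  "weak_derivative T y v \<longleftrightarrow> (\<forall>\<psi> \<psi>'. test_function T \<psi> \<psi>' \<longrightarrow>
     (LINT s|lebesgue_on {0<..<T}. \<psi>' s *\<^sub>R y s) = - (LINT s|lebesgue_on {0<..<T}. \<psi> s *\<^sub>R v s))"

(* An element of W^{1,oo}(0,T) is always taken as its continuous representative on [0,T],
   so that its values at single times (in particular at 0 and T) are meaningful. *)
definition W1inf :: "real \<Rightarrow> (real \<Rightarrow> 'a::euclidean_space) set" where
  "W1inf T = {y \<in> Linf T. continuous_on {0..T} y \<and> (\<exists>v\<in>Linf T. weak_derivative T y v)}"

(* The derivative of an element of W^{1,oo}(0,T). It is unique only up to null sets, and is
   used only in contexts that do not depend on the chosen representative. *)
definition ddt :: "real \<Rightarrow> (real \<Rightarrow> 'a::euclidean_space) \<Rightarrow> real \<Rightarrow> 'a" where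
  "ddt T y = (SOME v. v \<in> Linf T \<and> weak_derivative T y v)"

definition has_jump :: "(real \<Rightarrow> 'a::real_normed_vector) \<Rightarrow> real \<Rightarrow> 'a \<Rightarrow> bool" where
  "has_jump h t j \<longleftrightarrow> (\<exists>l r. (h \<longlongrightarrow> l) (at_left t) \<and> (h \<longlongrightarrow> r) (at_right t) \<and> j = r - l)"

(* Jump of a function that is defined only almost everywhere on (0,T). *)
definition has_ae_jump :: "real \<Rightarrow> (real \<Rightarrow> 'a::real_normed_vector) \<Rightarrow> real \<Rightarrow> 'a \<Rightarrow> bool" where
  "has_ae_jump T h t j \<longleftrightarrow>
     (\<exists>w. (AE s in lebesgue_on {0<..<T}. w s = h s) \<and> has_jump w t j)"

definition bounded_variation :: "real \<Rightarrow> (real \<Rightarrow> 'a::real_normed_vector) \<Rightarrow> bool" where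
  "bounded_variation T h \<longleftrightarrow> (\<exists>C. \<forall>N (\<tau> :: nat \<Rightarrow> real).
     (\<forall>i\<le>N. \<tau> i \<in> {0..T}) \<and> (\<forall>i<N. \<tau> i \<le> \<tau> (Suc i)) \<longrightarrow>
     (\<Sum>i<N. norm (h (\<tau> (Suc i)) - h (\<tau> i))) \<le> C)"

(* h is of bounded variation and dh = nu as measures on [0,T]. The convention is that h(0) and
   h(T) stand for h(0-) and h(T+), so that dh may have atoms at both end points:
   dh({0}) = h(0+) - h(0) and dh({T}) = h(T) - h(T-). The values of h at interior
   discontinuities are irrelevant. Equality of the two measures is expressed on the intervals
   [0,t], which generate the Borel sets of [0,T] and are closed under intersection. *)
definition has_bv_derivative ::
    "real \<Rightarrow> (real \<Rightarrow> 'a::real_normed_vector) \<Rightarrow> (real set \<Rightarrow> 'a) \<Rightarrow> bool" where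
  "has_bv_derivative T h \<nu> \<longleftrightarrow> bounded_variation T h \<and>
     (\<forall>t\<in>{0..T}. \<nu> {0..t} = (if t < T then Lim (at_right t) h else h T) - h 0)"

(* The nonnegative elements of the space of finite Radon measures on [0,T]: every finite Borel
   measure on a compact interval is Radon. *)
definition nonneg_Radon :: "real \<Rightarrow> real measure set" where
  "nonneg_Radon T = {m. sets m = sets (restrict_space borel {0..T}) \<and> finite_measure m}"

(* Covectors are identified with vectors: p y is the inner product of p and y, and p A is p v* A. *)
definition gradient :: "(real^'n \<Rightarrow> real) \<Rightarrow> real^'n \<Rightarrow> real^'n" where
  "gradient h y = (\<chi> j. frechet_derivative h (at y) (axis j 1))"

definition H_u :: "(real^'n \<Rightarrow> real^'n) \<Rightarrow> (real \<Rightarrow> real^'n) \<Rightarrow> (real \<Rightarrow> real^'n) \<Rightarrow> real \<Rightarrow> real" where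
  "H_u f1 x p s = p s \<bullet> f1 (x s)"

(* A vector of R^(n1+n2) is a function on nat of which only the values on {1..n1+n2} matter;
   n1 = 0 and n2 = 0 are allowed. *)
definition K_Phi :: "nat \<Rightarrow> nat \<Rightarrow> (nat \<Rightarrow> real) set" where
  "K_Phi n1 n2 = {y. (\<forall>i\<in>{1..n1}. y i = 0) \<and> (\<forall>i\<in>{n1+1..n1+n2}. y i \<le> 0)}"

definition feasible ::
    "real \<Rightarrow> (real^'n \<Rightarrow> real^'n) \<Rightarrow> (real^'n \<Rightarrow> real^'n) \<Rightarrow> (real^'n \<Rightarrow> real) \<Rightarrow>
     ((real^'n) \<times> (real^'n) \<Rightarrow> nat \<Rightarrow> real) \<Rightarrow> nat \<Rightarrow> nat \<Rightarrow> ereal \<Rightarrow> ereal \<Rightarrow>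
     (real \<Rightarrow> real) \<Rightarrow> (real \<Rightarrow> real^'n) \<Rightarrow> bool" where
  "feasible T f0 f1 g \<Phi> n1 n2 umin umax u x \<longleftrightarrow>
     u \<in> Linf T \<and> x \<in> W1inf T \<and>
     (AE s in lebesgue_on {0<..<T}. ddt T x s = f0 (x s) + u s *\<^sub>R f1 (x s)) \<and>
     \<Phi> (x 0, x T) \<in> K_Phi n1 n2 \<and>
     (AE s in lebesgue_on {0<..<T}. umin \<le> ereal (u s) \<and> ereal (u s) \<le> umax) \<and>
     (\<forall>s\<in>{0..T}. g (x s) \<le> 0)"

(* The last conjunct expresses minimality of the Hamiltonian v |-> p_s (f_0 + v f_1)(x_s) at
   v = u_s over the reals v with umin <= v <= umax. Its first three clauses are the usual
   complementarity form. The last two cover an infinite bound, where a minimizer exists only if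
   H_u has the right sign: e.g. for umax = oo the first three clauses alone would admit
   u_s = umin with H_u(s) < 0. *)
definition Lambda ::
    "real \<Rightarrow> (real^'n \<Rightarrow> real^'n) \<Rightarrow> (real^'n \<Rightarrow> real^'n) \<Rightarrow> ((real^'n) \<times> (real^'n) \<Rightarrow> real) \<Rightarrow>
     (real^'n \<Rightarrow> real) \<Rightarrow> ((real^'n) \<times> (real^'n) \<Rightarrow> nat \<Rightarrow> real) \<Rightarrow> nat \<Rightarrow> nat \<Rightarrow> ereal \<Rightarrow> ereal \<Rightarrow>
     (real \<Rightarrow> real) \<Rightarrow> (real \<Rightarrow> real^'n) \<Rightarrow>
     (real \<times> (nat \<Rightarrow> real) \<times> (real \<Rightarrow> real^'n) \<times> real measure) set" where
  "Lambda T f0 f1 \<phi> g \<Phi> n1 n2 umin umax u x = {(\<beta>, \<Psi>, p, d\<mu>).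
     \<beta> \<ge> 0 \<and> d\<mu> \<in> nonneg_Radon T \<and>
     (\<beta> \<noteq> 0 \<or> (\<exists>i\<in>{1..n1+n2}. \<Psi> i \<noteq> 0) \<or> measure d\<mu> {0..T} \<noteq> 0) \<and>
     (\<forall>i\<in>{n1+1..n1+n2}. \<Psi> i \<ge> 0 \<and> \<Psi> i * \<Phi> (x 0, x T) i = 0) \<and>
     (LINT s|d\<mu>. g (x s)) = 0 \<and>
     has_bv_derivative T p (\<lambda>A. - ((LINT s:A|lebesgue. p s v* jacobian (\<lambda>y. f0 y + u s *\<^sub>R f1 y) (at (x s)))
                                    + (LINT s:A|d\<mu>. gradient g (x s)))) \<and>
     (\<forall>y z. frechet_derivative (\<lambda>w. \<beta> * \<phi> w + (\<Sum>i\<in>{1..n1+n2}. \<Psi> i * \<Phi> w i)) (at (x 0, x T)) (y, z)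
              = - p 0 \<bullet> y + p T \<bullet> z) \<and>
     (AE s in lebesgue_on {0<..<T}.
        (umin \<noteq> -\<infinity> \<and> H_u f1 x p s > 0 \<longrightarrow> ereal (u s) = umin) \<and>
        (umax \<noteq> \<infinity> \<and> H_u f1 x p s < 0 \<longrightarrow> ereal (u s) = umax) \<and>
        (umin < ereal (u s) \<and> ereal (u s) < umax \<longrightarrow> H_u f1 x p s = 0) \<and>
        (umin = -\<infinity> \<longrightarrow> H_u f1 x p s \<le> 0) \<and>
        (umax = \<infinity> \<longrightarrow> H_u f1 x p s \<ge> 0))}"

end

theory Submission
  imports Defs
begin

text \<open>
  Write \<open>m\<close> for the mass of \<open>d\<mu>\<close> at \<open>t\<close>, and \<open>a\<close> for the scalar product of the gradient of \<open>g\<close> and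
  \<open>f1\<close> at \<open>x t\<close>. Three jumps can be computed. The function \<open>\<mu>\<close> jumps by \<open>m\<close>
  (\<open>distribution_function_jump\<close>). The costate \<open>p\<close> jumps by \<open>- m\<close> times the gradient of \<open>g\<close>
  (\<open>costate_jump\<close>), hence \<open>H_u\<close> jumps by \<open>- m a\<close>, the state being continuous. By the chain rule
  (\<open>W1inf_compose\<close>) the derivative of \<open>g(x)\<close> is \<open>g'(x) (f0(x) + u f1(x))\<close>, so it jumps by \<open>[u] a\<close>.
  Consequently \<open>[u] [H_u] = - m a [u] = - [\<mu>] [d/dt g(x)]\<close>, and both claims amount to the vanishing
  of one number, which is shown by giving it both signs.

  On the one hand, \<open>u\<close> minimizes the Hamiltonian, which is affine in the control, on both sides of
  \<open>t\<close>; comparing the two sides yields \<open>[u] [H_u] \<le> 0\<close> (\<open>minimizer_jump_sign\<close>). On the other hand,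
  if \<open>m > 0\<close>, then complementarity forces \<open>g(x t) = 0\<close> (\<open>atom_imp_active\<close>), so that the function
  \<open>g(x)\<close>, which is nowhere positive, has a maximum at \<open>t\<close>. Its derivative is then nonnegative just
  before and nonpositive just after \<open>t\<close> (\<open>max_one_sided_derivatives\<close>), and
  \<open>[\<mu>] [d/dt g(x)] \<le> 0\<close>.

  Two pieces of analysis support this. Functions of bounded variation with values in a Banach space
  are controlled by their real total variation, which provides one-sided limits, and measurability in
  the Euclidean case. Derivatives of Lipschitz functions are weak derivatives, that is, choices up to
  null sets; for these, the fundamental theorem of calculus (\<open>weak_derivative_imp_integral\<close>),
  uniqueness (\<open>weak_derivative_unique\<close>) and the chain rule are established.
\<close>

section \<open>Functions of bounded variation and their jumps\<close>

text \<open>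
  Take for \<open>V\<close> the total variation of \<open>h\<close> on \<open>[0,s]\<close>. It reduces the regularity of a vector-valued
  function of bounded variation to that of one real monotone function: wherever \<open>V\<close> is continuous
  or has a one-sided limit, so does \<open>h\<close>.
\<close>
lemma bounded_variation_dominating_mono:
  assumes "bounded_variation T h"
  obtains V :: "real \<Rightarrow> real"
  where "mono_on {0..T} V"
    and "\<And>a b. 0 \<le> a \<Longrightarrow> a \<le> b \<Longrightarrow> b \<le> T \<Longrightarrow> norm (h b - h a) \<le> V b - V a"
proof -
  obtain C where C: "\<And>N (\<tau> :: nat \<Rightarrow> real). \<lbrakk>\<forall>i\<le>N. \<tau> i \<in> {0..T}; \<forall>i<N. \<tau> i \<le> \<tau> (Suc i)\<rbrakk>
      \<Longrightarrow> (\<Sum>i<N. norm (h (\<tau> (Suc i)) - h (\<tau> i))) \<le> C"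
    using assms unfolding bounded_variation_def by blast
  define variations where "variations s = {(\<Sum>i<N. norm (h (\<tau> (Suc i)) - h (\<tau> i))) | N (\<tau> :: nat \<Rightarrow> real).
      (\<forall>i\<le>N. \<tau> i \<in> {0..s}) \<and> (\<forall>i<N. \<tau> i \<le> \<tau> (Suc i))}" for s
  define V where "V s = Sup (variations s)" for s
  have bdd: "bdd_above (variations s)" if "s \<le> T" for s
  proof (rule bdd_aboveI)
    fix r assume "r \<in> variations s"
    then obtain N and \<tau> :: "nat \<Rightarrow> real" where r: "r = (\<Sum>i<N. norm (h (\<tau> (Suc i)) - h (\<tau> i)))"
      and \<tau>: "\<forall>i\<le>N. \<tau> i \<in> {0..s}" "\<forall>i<N. \<tau> i \<le> \<tau> (Suc i)"
      unfolding variations_def by blast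
    show "r \<le> C" unfolding r by (rule C) (use \<tau> that in force)+
  qed
  have ne: "variations s \<noteq> {}" if "0 \<le> s" for s
  proof -
    have "(\<Sum>i<0. norm (h ((\<lambda>_. 0) (Suc i)) - h ((\<lambda>_. 0) i))) \<in> variations s"
      unfolding variations_def using that by (intro CollectI exI[of _ 0] exI[of _ "\<lambda>_. 0"]) auto
    then show ?thesis by blast
  qed
  have incr: "norm (h b - h a) \<le> V b - V a" if ab: "0 \<le> a" "a \<le> b" "b \<le> T" for a b
  proof -
    have "V a \<le> V b - norm (h b - h a)"
      unfolding V_def[of a]
    proof (rule cSup_least[OF ne])
      fix r assume "r \<in> variations a"
      then obtain N and \<tau> :: "nat \<Rightarrow> real" where r: "r = (\<Sum>i<N. norm (h (\<tau> (Suc i)) - h (\<tau> i)))"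
        and \<tau>: "\<forall>i\<le>N. \<tau> i \<in> {0..a}" "\<forall>i<N. \<tau> i \<le> \<tau> (Suc i)"
        unfolding variations_def by blast
      \<comment> \<open>Refine the partition by appending the two points \<open>a\<close> and \<open>b\<close>.\<close>
      define \<sigma> where "\<sigma> i = (if i \<le> N then \<tau> i else if i = Suc N then a else b)" for i
      have "(\<Sum>i<N. norm (h (\<sigma> (Suc i)) - h (\<sigma> i))) = r"
        unfolding r by (rule sum.cong) (auto simp: \<sigma>_def)
      then have "(\<Sum>i<Suc (Suc N). norm (h (\<sigma> (Suc i)) - h (\<sigma> i)))
          = r + norm (h a - h (\<tau> N)) + norm (h b - h a)"
        by (simp add: \<sigma>_def)
      moreover have "(\<Sum>i<Suc (Suc N). norm (h (\<sigma> (Suc i)) - h (\<sigma> i))) \<in> variations b"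
      proof -
        have "\<forall>i\<le>Suc (Suc N). \<sigma> i \<in> {0..b}" "\<forall>i<Suc (Suc N). \<sigma> i \<le> \<sigma> (Suc i)"
          using \<tau> ab by (force simp: \<sigma>_def)+
        then show ?thesis unfolding variations_def by blast
      qed
      then have "(\<Sum>i<Suc (Suc N). norm (h (\<sigma> (Suc i)) - h (\<sigma> i))) \<le> V b"
        unfolding V_def by (rule cSup_upper) (rule bdd[OF \<open>b \<le> T\<close>])
      ultimately show "r \<le> V b - norm (h b - h a)"
        using norm_ge_zero[of "h a - h (\<tau> N)"] by linarith
    qed (use ab in auto)
    then show ?thesis by simp
  qed
  show ?thesis
  proof
    show "mono_on {0..T} V"
    proof (rule mono_onI)
      fix a b assume "a \<in> {0..T}" "b \<in> {0..T}" "a \<le> b"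
      then have "norm (h b - h a) \<le> V b - V a" by (intro incr) auto
      then show "V a \<le> V b" using norm_ge_zero[of "h b - h a"] by linarith
    qed
  qed (rule incr)
qed

text \<open>
  Along a sequence that tends to \<open>t\<close> the values of \<open>V\<close>, hence those of \<open>h\<close>, form a Cauchy sequence.
  Its limit is the limit of \<open>h\<close>, because the domination survives the passage to the limit in one of
  the two points.
\<close>
lemma tendsto_if_increments_dominated:
  fixes h :: "'c::first_countable_topology \<Rightarrow> 'a::banach" and V :: "'c \<Rightarrow> real"
  assumes lim: "(V \<longlongrightarrow> L) (at t within D)" and nontriv: "at t within D \<noteq> bot"
    and dom: "\<And>a b. a \<in> D \<Longrightarrow> b \<in> D \<Longrightarrow> norm (h b - h a) \<le> \<bar>V b - V a\<bar>"
  shows "\<exists>l. (h \<longlongrightarrow> l) (at t within D)"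
proof -
  have "t islimpt D" using nontriv by (simp add: trivial_limit_within)
  then obtain \<sigma> where \<sigma>: "\<And>n. \<sigma> n \<in> D - {t}" "\<sigma> \<longlonglongrightarrow> t"
    unfolding islimpt_sequential by auto
  have V\<sigma>: "(\<lambda>n. V (\<sigma> n)) \<longlonglongrightarrow> L"
    using \<sigma> lim unfolding tendsto_at_iff_sequentially comp_def by blast
  have "Cauchy (\<lambda>n. h (\<sigma> n))"
  proof (rule metric_CauchyI)
    fix e :: real assume "0 < e"
    then obtain M where M: "\<And>m n. M \<le> m \<Longrightarrow> M \<le> n \<Longrightarrow> dist (V (\<sigma> m)) (V (\<sigma> n)) < e"
      using LIMSEQ_imp_Cauchy[OF V\<sigma>] unfolding Cauchy_def by blast
    show "\<exists>M. \<forall>m\<ge>M. \<forall>n\<ge>M. dist (h (\<sigma> m)) (h (\<sigma> n)) < e"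
    proof (intro exI allI impI)
      fix m n assume "M \<le> m" "M \<le> n"
      then show "dist (h (\<sigma> m)) (h (\<sigma> n)) < e"
        using M[of m n] dom[of "\<sigma> n" "\<sigma> m"] \<sigma>(1) by (auto simp: dist_norm dist_real_def)
    qed
  qed
  then obtain l where l: "(\<lambda>n. h (\<sigma> n)) \<longlonglongrightarrow> l"
    using Cauchy_convergent convergent_def by blast
  have le: "norm (h s - l) \<le> \<bar>V s - L\<bar>" if "s \<in> D" for s
  proof (rule LIMSEQ_le)
    show "(\<lambda>n. norm (h s - h (\<sigma> n))) \<longlonglongrightarrow> norm (h s - l)" by (intro tendsto_intros l)
    show "(\<lambda>n. \<bar>V s - V (\<sigma> n)\<bar>) \<longlonglongrightarrow> \<bar>V s - L\<bar>" by (intro tendsto_intros V\<sigma>)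
    show "\<exists>N. \<forall>n\<ge>N. norm (h s - h (\<sigma> n)) \<le> \<bar>V s - V (\<sigma> n)\<bar>" using dom that \<sigma>(1) by auto
  qed
  have "((\<lambda>s. h s - l) \<longlongrightarrow> 0) (at t within D)"
  proof (rule Lim_null_comparison)
    show "eventually (\<lambda>s. norm (h s - l) \<le> \<bar>V s - L\<bar>) (at t within D)"
      using le by (auto simp: eventually_at_filter)
    show "((\<lambda>s. \<bar>V s - L\<bar>) \<longlongrightarrow> 0) (at t within D)"
      using lim by (simp add: LIM_zero tendsto_rabs_zero)
  qed
  then show ?thesis using LIM_zero_cancel by blast
qed

lemma mono_on_one_sided_limits:
  fixes V :: "real \<Rightarrow> real"
  assumes V: "mono_on {a..b} V" and t: "a < t" "t < b"
  shows "\<exists>l. (V \<longlongrightarrow> l) (at t within {a..<t})" "\<exists>r. (V \<longlongrightarrow> r) (at t within {t<..b})"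
proof -
  have m: "V r \<le> V s" if "a \<le> r" "r \<le> s" "s \<le> b" for r s
    using that V by (auto simp: mono_on_def)
  have bl: "bdd_above (V ` {a..<t})" using m t by (intro bdd_aboveI[of _ "V b"]) auto
  have br: "bdd_below (V ` {t<..b})" using m t by (intro bdd_belowI[of _ "V a"]) auto
  have "(V \<longlongrightarrow> Sup (V ` {a..<t})) (at t within {a..<t})"
  proof (rule order_tendstoI)
    fix y assume "y < Sup (V ` {a..<t})"
    then obtain s where s: "a \<le> s" "s < t" "y < V s" using t bl by (subst (asm) less_cSup_iff) auto
    show "eventually (\<lambda>s. y < V s) (at t within {a..<t})"
      unfolding eventually_at_topological
    proof (intro exI[of _ "{s<..}"] conjI ballI impI)
      fix r assume "r \<in> {s<..}" "r \<in> {a..<t}"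
      then show "y < V r" using m[of s r] s t by auto
    qed (use s in auto)
  next
    fix y assume y: "Sup (V ` {a..<t}) < y"
    have "V r < y" if "r \<in> {a..<t}" for r
      using cSup_upper[OF imageI[OF that] bl] y by linarith
    then show "eventually (\<lambda>s. V s < y) (at t within {a..<t})"
      by (auto simp: eventually_at_filter)
  qed
  then show "\<exists>l. (V \<longlongrightarrow> l) (at t within {a..<t})" ..
  have "(V \<longlongrightarrow> Inf (V ` {t<..b})) (at t within {t<..b})"
  proof (rule order_tendstoI)
    fix y assume "Inf (V ` {t<..b}) < y"
    then obtain s where s: "t < s" "s \<le> b" "V s < y" using t br by (subst (asm) cInf_less_iff) auto
    show "eventually (\<lambda>s. V s < y) (at t within {t<..b})"
      unfolding eventually_at_topological
    proof (intro exI[of _ "{..<s}"] conjI ballI impI)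
      fix r assume "r \<in> {..<s}" "r \<in> {t<..b}"
      then show "V r < y" using m[of r s] s t by auto
    qed (use s in auto)
  next
    fix y assume y: "y < Inf (V ` {t<..b})"
    have "y < V r" if "r \<in> {t<..b}" for r
      using cInf_lower[OF imageI[OF that] br] y by linarith
    then show "eventually (\<lambda>s. y < V s) (at t within {t<..b})"
      by (auto simp: eventually_at_filter)
  qed
  then show "\<exists>r. (V \<longlongrightarrow> r) (at t within {t<..b})" ..
qed

lemma bounded_variation_one_sided_limits:
  fixes h :: "real \<Rightarrow> 'a::banach"
  assumes h: "bounded_variation T h" and t: "0 < t" "t < T"
  shows "\<exists>l. (h \<longlongrightarrow> l) (at_left t)" "\<exists>r. (h \<longlongrightarrow> r) (at_right t)"
proof -
  obtain V where V: "mono_on {0..T} V"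
    and dom: "\<And>a b. 0 \<le> a \<Longrightarrow> a \<le> b \<Longrightarrow> b \<le> T \<Longrightarrow> norm (h b - h a) \<le> V b - V a"
    using bounded_variation_dominating_mono[OF h] by blast
  have dom': "norm (h b - h a) \<le> \<bar>V b - V a\<bar>" if "a \<in> {0..T}" "b \<in> {0..T}" for a b
  proof (cases "a \<le> b")
    case True then show ?thesis using dom[of a b] that by auto
  next
    case False then show ?thesis using dom[of b a] that by (auto simp: norm_minus_commute)
  qed
  have L: "at t within {0..<t} = at_left t"
    by (rule at_within_nhd[of _ "{0<..}"]) (use t in auto)
  have R: "at t within {t<..T} = at_right t"
    by (rule at_within_nhd[of _ "{..<T}"]) (use t in auto)
  obtain l where "(V \<longlongrightarrow> l) (at t within {0..<t})" using mono_on_one_sided_limits(1)[OF V t] ..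
  then have "\<exists>l. (h \<longlongrightarrow> l) (at t within {0..<t})"
    by (rule tendsto_if_increments_dominated) (use dom' t L in auto)
  then show "\<exists>l. (h \<longlongrightarrow> l) (at_left t)" unfolding L .
  obtain r where "(V \<longlongrightarrow> r) (at t within {t<..T})" using mono_on_one_sided_limits(2)[OF V t] ..
  then have "\<exists>l. (h \<longlongrightarrow> l) (at t within {t<..T})"
    by (rule tendsto_if_increments_dominated) (use dom' t R in auto)
  then show "\<exists>l. (h \<longlongrightarrow> l) (at_right t)" unfolding R .
qed

lemma bounded_variation_bounded:
  assumes "bounded_variation T h"
  shows "\<exists>B. \<forall>s\<in>{0..T}. norm (h s) \<le> B"
proof -
  obtain V where V: "mono_on {0..T} V"
    and dom: "\<And>a b. 0 \<le> a \<Longrightarrow> a \<le> b \<Longrightarrow> b \<le> T \<Longrightarrow> norm (h b - h a) \<le> V b - V a"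
    using bounded_variation_dominating_mono[OF assms] by blast
  have "norm (h s) \<le> norm (h 0) + (V T - V 0)" if s: "s \<in> {0..T}" for s
  proof -
    have "norm (h s) \<le> norm (h 0) + norm (h s - h 0)" by (metis norm_triangle_sub)
    moreover have "V s \<le> V T" using V s by (auto simp: mono_on_def)
    ultimately show ?thesis using dom[of 0 s] s by auto
  qed
  then show ?thesis by blast
qed

text \<open>
  By domination, \<open>h\<close> is continuous at every continuity point of the monotone function \<open>V\<close>, that is,
  outside a countable set.
\<close>
lemma bounded_variation_measurable:
  fixes h :: "real \<Rightarrow> 'a::euclidean_space"
  assumes "bounded_variation T h"
  shows "h \<in> borel_measurable (lebesgue_on {0<..<T})"
proof -
  obtain V where V: "mono_on {0..T} V"
    and dom: "\<And>a b. 0 \<le> a \<Longrightarrow> a \<le> b \<Longrightarrow> b \<le> T \<Longrightarrow> norm (h b - h a) \<le> V b - V a"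
    using bounded_variation_dominating_mono[OF assms] by blast
  have V': "mono_on {0<..<T} V" using V by (auto simp: mono_on_def)
  define X where "X = {s \<in> {0<..<T}. \<not> isCont V s} \<union> {0, T}"
  have "countable X" unfolding X_def using mono_on_ctble_discont_open[OF _ V'] by simp
  \<comment> \<open>Extended by 0 outside the open interval, \<open>h\<close> can only be discontinuous on \<open>X\<close>.\<close>
  define k where "k s = (if s \<in> {0<..<T} then h s else 0)" for s
  have "isCont k s" if s: "s \<notin> X" for s
  proof (cases "s \<in> {0<..<T}")
    case True
    then have cV: "isCont V s" using s by (auto simp: X_def)
    have nbh: "eventually (\<lambda>r. r \<in> {0<..<T}) (at s)"
      using True by (intro eventually_at_in_open') auto
    have "((\<lambda>r. k r - k s) \<longlongrightarrow> 0) (at s)"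
    proof (rule Lim_null_comparison)
      show "eventually (\<lambda>r. norm (k r - k s) \<le> \<bar>V r - V s\<bar>) (at s)"
        using nbh
      proof eventually_elim
        case (elim r)
        then show ?case using True dom[of r s] dom[of s r] unfolding k_def
          by (cases "r \<le> s") (auto simp: norm_minus_commute)
      qed
      have "((\<lambda>r. V r - V s) \<longlongrightarrow> 0) (at s)" using cV LIM_zero isCont_def by blast
      then show "((\<lambda>r. \<bar>V r - V s\<bar>) \<longlongrightarrow> 0) (at s)" by (rule tendsto_rabs_zero)
    qed
    then show ?thesis using LIM_zero_cancel isCont_def by blast
  next
    case False
    then have "s < 0 \<or> T < s \<or> T \<le> 0" using s by (auto simp: X_def)
    then have "eventually (\<lambda>r. k r = 0) (nhds s)"
    proof (elim disjE)
      assume "s < 0"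
      then have "eventually (\<lambda>r. r \<in> {..<0}) (nhds s)" by (intro eventually_nhds_in_open) auto
      then show ?thesis by eventually_elim (auto simp: k_def)
    next
      assume "T < s"
      then have "eventually (\<lambda>r. r \<in> {T<..}) (nhds s)" by (intro eventually_nhds_in_open) auto
      then show ?thesis by eventually_elim (auto simp: k_def)
    qed (auto simp: k_def)
    then show ?thesis using isCont_cong[of k "\<lambda>_. 0" s] by simp
  qed
  then have "continuous_on (- X) k" by (simp add: continuous_at_imp_continuous_on)
  then have "k \<in> borel_measurable borel"
    using borel_measurable_continuous_countable_exceptions \<open>countable X\<close> by blast
  then have "k \<in> borel_measurable lebesgue" by (simp add: measurable_completion)
  then have "k \<in> borel_measurable (lebesgue_on {0<..<T})" by (rule measurable_restrict_space1)
  then show ?thesis by (rule measurable_cong[THEN iffD1, rotated]) (simp add: k_def)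
qed

text \<open>
  The number \<open>\<nu> {0..s}\<close> encodes the right limit of \<open>h\<close> at \<open>s\<close>, and for \<open>s\<close> increasing to \<open>t\<close> these
  right limits converge to the left limit of \<open>h\<close> at \<open>t\<close>. So the jump of \<open>h\<close> is the mass that \<open>\<nu>\<close>
  gives to the single point \<open>t\<close>.
\<close>
lemma bv_derivative_jump:
  fixes h :: "real \<Rightarrow> 'a::banach"
  assumes bv: "has_bv_derivative T h \<nu>" and t: "0 < t" "t < T"
    and left: "((\<lambda>s. \<nu> {0..s}) \<longlongrightarrow> L) (at_left t)"
  shows "has_jump h t (\<nu> {0..t} - L)"
proof -
  have BV: "bounded_variation T h"
    and \<nu>: "\<And>s. s \<in> {0..T} \<Longrightarrow> \<nu> {0..s} = (if s < T then Lim (at_right s) h else h T) - h 0"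
    using bv unfolding has_bv_derivative_def by auto
  have \<nu>_right: "(h \<longlongrightarrow> \<nu> {0..s} + h 0) (at_right s)" if s: "0 < s" "s < T" for s
  proof -
    obtain r where r: "(h \<longlongrightarrow> r) (at_right s)"
      using bounded_variation_one_sided_limits(2)[OF BV s] by blast
    then have "Lim (at_right s) h = r" by (intro tendsto_Lim) auto
    then show ?thesis using \<nu>[of s] s r by simp
  qed
  obtain l where l: "(h \<longlongrightarrow> l) (at_left t)"
    using bounded_variation_one_sided_limits(1)[OF BV t] by blast
  \<comment> \<open>The left limit of the right limits of \<open>h\<close> is the left limit of \<open>h\<close>.\<close>
  have "((\<lambda>s. \<nu> {0..s} + h 0) \<longlongrightarrow> l) (at_left t)"
  proof (rule tendstoI)
    fix e :: real assume "0 < e"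
    then have "eventually (\<lambda>s. dist (h s) l < e/2) (at_left t)" using l by (intro tendstoD) auto
    then obtain b where b: "b < t" "\<And>s. b < s \<Longrightarrow> s < t \<Longrightarrow> dist (h s) l < e/2"
      unfolding eventually_at_left[OF t(1)] by auto
    have "eventually (\<lambda>s. s \<in> {max b 0<..<t}) (at_left t)"
      by (rule eventually_at_leftI[of "max b 0"]) (use b t in auto)
    then show "eventually (\<lambda>s. dist (\<nu> {0..s} + h 0) l < e) (at_left t)"
    proof eventually_elim
      case (elim s)
      have "dist (\<nu> {0..s} + h 0) l \<le> e/2"
      proof (rule tendsto_upperbound)
        show "((\<lambda>r. dist (h r) l) \<longlongrightarrow> dist (\<nu> {0..s} + h 0) l) (at_right s)"
          using elim t by (intro tendsto_intros \<nu>_right) auto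
        have "eventually (\<lambda>r. r \<in> {s<..<t}) (at_right s)"
          by (rule eventually_at_rightI[of _ t]) (use elim in auto)
        then show "eventually (\<lambda>r. dist (h r) l \<le> e/2) (at_right s)"
          by eventually_elim (use b elim in \<open>auto intro!: less_imp_le\<close>)
      qed auto
      then show ?case using \<open>0 < e\<close> by linarith
    qed
  qed
  moreover have "((\<lambda>s. \<nu> {0..s} + h 0) \<longlongrightarrow> L + h 0) (at_left t)" by (intro tendsto_intros left)
  ultimately have "l = L + h 0" by (rule tendsto_unique[OF trivial_limit_at_left_real])
  then show ?thesis unfolding has_jump_def using l \<nu>_right[OF t] by fastforce
qed

text \<open>
  By dominated convergence the limit is the integral over \<open>{0..<t}\<close>, which misses exactly the
  contribution of the atom at \<open>t\<close>.
\<close>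
lemma set_integral_left_limit:
  fixes f :: "real \<Rightarrow> 'a::{banach, second_countable_topology}"
  assumes int: "set_integrable M {0..T} f" and t: "0 < t" "t < T"
    and M: "\<And>s. 0 \<le> s \<Longrightarrow> s \<le> T \<Longrightarrow> {0..s} \<in> sets M" "{t} \<in> sets M"
    and fin: "emeasure M {t} < \<infinity>"
  shows "((\<lambda>s. LINT r:{0..s}|M. f r) \<longlongrightarrow> (LINT r:{0..t}|M. f r) - measure M {t} *\<^sub>R f t) (at_left t)"
proof -
  have meas: "{0..<t} \<in> sets M"
  proof -
    have "{0..<t} = {0..t} - {t}" using t by auto
    then show ?thesis using M t by auto
  qed
  have int_sub: "set_integrable M A f" if "A \<in> sets M" "A \<subseteq> {0..T}" for A
    using set_integrable_subset[OF int] that by blast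
  have int_left: "set_integrable M {0..<t} f" using t by (intro int_sub meas) auto
  have int_pt: "set_integrable M {t} f" using t by (intro int_sub M) auto
  have "((\<lambda>s. LINT r:{0..s}|M. f r) \<longlongrightarrow> (LINT r:{0..<t}|M. f r)) (at_left t)"
  proof (rule tendsto_at_left_sequentially[of 0])
    fix S assume S: "\<And>n. S n < t" "\<And>n. 0 < S n" "incseq S" "S \<longlonglongrightarrow> t"
    show "(\<lambda>n. LINT r:{0..S n}|M. f r) \<longlonglongrightarrow> (LINT r:{0..<t}|M. f r)"
      unfolding set_lebesgue_integral_def
    proof (rule integral_dominated_convergence)
      show "integrable M (\<lambda>r. norm (indicator {0..T} r *\<^sub>R f r))"
        using int unfolding set_integrable_def by (rule integrable_norm)
      show "(\<lambda>r. indicat_real {0..<t} r *\<^sub>R f r) \<in> borel_measurable M"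
        using int_left unfolding set_integrable_def by (rule borel_measurable_integrable)
      show "(\<lambda>r. indicat_real {0..S n} r *\<^sub>R f r) \<in> borel_measurable M" for n
      proof -
        have "{0..S n} \<in> sets M" "{0..S n} \<subseteq> {0..T}"
          using M(1)[of "S n"] S(1,2)[of n] t by auto
        then have "set_integrable M {0..S n} f" by (rule int_sub)
        then show ?thesis unfolding set_integrable_def by (rule borel_measurable_integrable)
      qed
      show "AE r in M. norm (indicat_real {0..S n} r *\<^sub>R f r) \<le> norm (indicat_real {0..T} r *\<^sub>R f r)" for n
        using S(1)[of n] t by (intro AE_I2) (auto simp: indicator_def)
      show "AE r in M. (\<lambda>n. indicat_real {0..S n} r *\<^sub>R f r) \<longlonglongrightarrow> indicat_real {0..<t} r *\<^sub>R f r"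
      proof (intro AE_I2 tendsto_eventually)
        fix r
        show "eventually (\<lambda>n. indicat_real {0..S n} r *\<^sub>R f r = indicat_real {0..<t} r *\<^sub>R f r) sequentially"
        proof (cases "r < t")
          case True
          with S(4) have "eventually (\<lambda>n. r < S n) sequentially" by (rule order_tendstoD)
          then show ?thesis by eventually_elim (use True in \<open>auto simp: indicator_def\<close>)
        next
          case False
          have "indicat_real {0..S n} r *\<^sub>R f r = indicat_real {0..<t} r *\<^sub>R f r" for n
            using False S(1)[of n] by (auto simp: indicator_def)
          then show ?thesis by simp
        qed
      qed
    qed
  qed (use t in auto)
  moreover have "(LINT r:{0..t}|M. f r) = (LINT r:{0..<t}|M. f r) + measure M {t} *\<^sub>R f t"
  proof -
    have "{0..t} = {0..<t} \<union> {t}" using t by auto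
    then have "(LINT r:{0..t}|M. f r) = (LINT r:{0..<t}|M. f r) + (LINT r:{t}|M. f r)"
      using int_left int_pt by (simp only:) (rule set_integral_Un, auto)
    moreover have "(LINT r:{t}|M. f r) = (LINT r:{t}|M. f t)"
      by (rule set_lebesgue_integral_cong) (use M in auto)
    moreover have "\<dots> = measure M {t} *\<^sub>R f t"
      using M fin by (simp add: set_lebesgue_integral_def)
    ultimately show ?thesis by simp
  qed
  ultimately show ?thesis by simp
qed

section \<open>Weak derivatives: fundamental theorem and uniqueness\<close>

lemma lebesgue_on_integral_superset:
  fixes F :: "real \<Rightarrow> 'a::euclidean_space"
  assumes "S \<subseteq> U" "S \<in> sets lebesgue" "U \<in> sets lebesgue" "\<And>s. s \<in> U - S \<Longrightarrow> F s = 0"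
  shows "(LINT s|lebesgue_on U. F s) = (LINT s|lebesgue_on S. F s)"
proof -
  have "(LINT s|lebesgue_on U. F s) = (LINT s|lebesgue. indicator U s *\<^sub>R F s)"
    using assms by (intro integral_restrict_space) auto
  also have "\<dots> = (LINT s|lebesgue. indicator S s *\<^sub>R F s)"
    by (rule Bochner_Integration.integral_cong) (use assms in \<open>auto simp: indicator_def\<close>)
  also have "\<dots> = (LINT s|lebesgue_on S. F s)"
    using assms by (intro integral_restrict_space[symmetric]) auto
  finally show ?thesis .
qed

lemma bounded_measurable_integrable:
  fixes f :: "real \<Rightarrow> 'a::euclidean_space"
  assumes "f \<in> borel_measurable (lebesgue_on S)" "S \<in> lmeasurable" "\<And>s. s \<in> S \<Longrightarrow> norm (f s) \<le> C"
  shows "integrable (lebesgue_on S) f"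
proof (rule finite_measure.integrable_const_bound[where B = C])
  show "finite_measure (lebesgue_on S)" using assms(2) by (rule finite_measure_lebesgue_on)
  show "AE s in lebesgue_on S. norm (f s) \<le> C"
    using assms by (intro AE_I2) auto
qed (use assms in auto)

lemma AE_lebesgue_onI:
  assumes "negligible N" "S \<in> sets lebesgue" "\<And>s. s \<in> S \<Longrightarrow> s \<notin> N \<Longrightarrow> P s"
  shows "AE s in lebesgue_on S. P s"
proof -
  have "AE s in lebesgue. s \<notin> N" using assms(1) negligible_iff_null_sets AE_not_in by blast
  then have "AE s in lebesgue. s \<in> S \<longrightarrow> P s" by eventually_elim (use assms in auto)
  then show ?thesis using assms(2) by (simp add: AE_restrict_space_iff)
qed

lemma AE_lebesgue_on_subset:
  assumes "AE s in lebesgue_on U. P s" "S \<subseteq> U" "S \<in> sets lebesgue" "U \<in> sets lebesgue"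
  shows "AE s in lebesgue_on S. P s"
proof -
  have "AE s in lebesgue. s \<in> U \<longrightarrow> P s" using assms by (simp add: AE_restrict_space_iff)
  then have "AE s in lebesgue. s \<in> S \<longrightarrow> P s" by eventually_elim (use assms in auto)
  then show ?thesis using assms by (simp add: AE_restrict_space_iff)
qed

text \<open>
  A continuously differentiable transition from 0 to 1 across \<open>[0,1]\<close>. Combining three shifted copies
  of the square of the positive part makes the derivative valid at the junction points as well,
  since each copy is continuously differentiable on the whole line. The derivative is a hat function
  supported in \<open>[0,1]\<close>.
\<close>
definition smooth_step :: "real \<Rightarrow> real" where
  "smooth_step r = 2 * (max 0 r)\<^sup>2 - 4 * (max 0 (r - 1/2))\<^sup>2 + 2 * (max 0 (r - 1))\<^sup>2"

definition hat :: "real \<Rightarrow> real" where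
  "hat r = 4 * max 0 r - 8 * max 0 (r - 1/2) + 4 * max 0 (r - 1)"

lemma smooth_step_eq_0: "r \<le> 0 \<Longrightarrow> smooth_step r = 0"
  by (simp add: smooth_step_def)

lemma smooth_step_eq_1: "1 \<le> r \<Longrightarrow> smooth_step r = 1"
  by (simp add: smooth_step_def power2_eq_square algebra_simps)

lemma hat_nonneg: "0 \<le> hat r"
  by (simp add: hat_def max_def)

lemma hat_eq_0: "r \<le> 0 \<or> 1 \<le> r \<Longrightarrow> hat r = 0"
  by (auto simp: hat_def max_def)

lemma continuous_on_hat: "continuous_on A hat"
  unfolding hat_def[abs_def] by (intro continuous_intros)

lemma max_0_square_derivative:
  "((\<lambda>r::real. (max 0 r)\<^sup>2) has_real_derivative 2 * max 0 r) (at r)"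
proof -
  consider "r < 0" | "r = 0" | "0 < r" by linarith
  then show ?thesis
  proof cases
    case 1
    have "((\<lambda>r::real. 0) has_real_derivative 0) (at r)" by simp
    then show ?thesis
      by (rule DERIV_cong_ev[THEN iffD1, rotated 3])
         (use 1 eventually_nhds_in_open[of "{..<0}" r] in \<open>auto elim!: eventually_mono\<close>)
  next
    case 2
    have "((\<lambda>h::real. (max 0 h)\<^sup>2 / h) \<longlongrightarrow> 0) (at 0)"
      by (rule Lim_null_comparison[of _ "\<lambda>h. \<bar>h\<bar>"])
         (auto simp: max_def power2_eq_square intro!: tendsto_eq_intros)
    then show ?thesis using 2 by (simp add: DERIV_def)
  next
    case 3
    have "((\<lambda>r::real. r\<^sup>2) has_real_derivative 2 * r) (at r)" by (auto intro!: derivative_eq_intros)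
    then show ?thesis
      by (rule DERIV_cong_ev[THEN iffD1, rotated 3])
         (use 3 eventually_nhds_in_open[of "{0<..}" r] in \<open>auto elim!: eventually_mono\<close>)
  qed
qed

lemma smooth_step_derivative: "(smooth_step has_real_derivative hat r) (at r)"
proof -
  have shift: "((\<lambda>r::real. (max 0 (r - c))\<^sup>2) has_real_derivative 2 * max 0 (r - c)) (at r)" for c
  proof -
    have "((\<lambda>r::real. r - c) has_real_derivative 1) (at r)" by (auto intro!: derivative_eq_intros)
    from DERIV_chain2[OF max_0_square_derivative this] show ?thesis by simp
  qed
  have "(smooth_step has_real_derivative
      2 * (2 * max 0 r) - 4 * (2 * max 0 (r - 1/2)) + 2 * (2 * max 0 (r - 1))) (at r)"
    unfolding smooth_step_def[abs_def]
    by (intro DERIV_add DERIV_diff DERIV_cmult max_0_square_derivative shift)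
  then show ?thesis by (simp add: hat_def)
qed

lemma smooth_step_bound: "\<bar>smooth_step r\<bar> \<le> 1"
proof -
  have mono: "smooth_step r \<le> smooth_step s" if "r \<le> s" for r s
    using that by (rule DERIV_nonneg_imp_nondecreasing) (use smooth_step_derivative hat_nonneg in blast)
  have "0 \<le> smooth_step r"
    using mono[of "min 0 r" r] smooth_step_eq_0[of "min 0 r"] by auto
  moreover have "smooth_step r \<le> 1"
    using mono[of r "max 1 r"] smooth_step_eq_1[of "max 1 r"] by auto
  ultimately show ?thesis by simp
qed

lemma scaled_smooth_step_derivative:
  "((\<lambda>s. smooth_step (k * (s - c))) has_real_derivative k * hat (k * (s - c))) (at s)"
proof -
  have "((\<lambda>s. k * (s - c)) has_real_derivative k) (at s)" by (auto intro!: derivative_eq_intros)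
  from DERIV_chain2[OF smooth_step_derivative this] show ?thesis by (simp add: mult.commute)
qed

lemma continuous_on_scaled_hat: "continuous_on A (\<lambda>s. k * hat (k * (s - c)))"
  by (intro continuous_intros continuous_on_compose2[OF continuous_on_hat[of UNIV]]) auto

lemma continuous_on_interval_integrable:
  fixes F :: "real \<Rightarrow> 'a::euclidean_space"
  assumes "continuous_on {0..T} F"
  shows "integrable (lebesgue_on {0<..<T}) F"
proof -
  have "compact (F ` {0..T})" using assms by (intro compact_continuous_image) auto
  then obtain B where B: "\<And>s. s \<in> {0..T} \<Longrightarrow> norm (F s) \<le> B"
    using compact_imp_bounded bounded_iff by (metis imageI)
  have "continuous_on {0<..<T} F" by (rule continuous_on_subset[OF assms]) auto
  then have "F \<in> borel_measurable (lebesgue_on {0<..<T})"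
    by (rule continuous_imp_measurable_on_sets_lebesgue) auto
  then show ?thesis by (rule bounded_measurable_integrable[where C = B]) (use B in auto)
qed

text \<open>
  The scaled hats are probability densities supported in \<open>[c, c + 1/k]\<close>, so they converge to a Dirac
  mass at \<open>c\<close> when tested against a continuous function.
\<close>
lemma hat_averages_tendsto:
  fixes y :: "real \<Rightarrow> 'a::euclidean_space"
  assumes y: "continuous_on {0..T} y" and c: "0 < c"
    and k: "filterlim k at_top sequentially" "\<And>n. 0 < k n" "\<And>n. c + 1 / k n < T"
  shows "(\<lambda>n. LINT s|lebesgue_on {0<..<T}. (k n * hat (k n * (s - c))) *\<^sub>R y s) \<longlonglongrightarrow> y c"
proof (rule LIMSEQ_I)
  fix e :: real assume "0 < e"
  have cT: "c < T" using k(2)[of 0] k(3)[of 0] by (smt (verit) divide_pos_pos)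
  obtain d where d: "0 < d" "\<And>s. s \<in> {0..T} \<Longrightarrow> dist s c < d \<Longrightarrow> dist (y s) (y c) < e/2"
    using y c cT \<open>0 < e\<close> unfolding continuous_on_iff
    by (metis (mono_tags, lifting) atLeastAtMost_iff half_gt_zero less_imp_le)
  have "eventually (\<lambda>n. 1/d < k n) sequentially"
    using k(1) filterlim_at_top_dense by blast
  then obtain n0 where n0: "\<And>n. n0 \<le> n \<Longrightarrow> 1/d < k n"
    unfolding eventually_sequentially by blast
  show "\<exists>n0. \<forall>n\<ge>n0. norm ((LINT s|lebesgue_on {0<..<T}. (k n * hat (k n * (s - c))) *\<^sub>R y s) - y c) < e"
  proof (intro exI[of _ n0] allI impI)
    fix n assume "n0 \<le> n"
    define I where "I = {c..c + 1/k n}"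
    define \<rho> where "\<rho> s = k n * hat (k n * (s - c))" for s
    have kn: "0 < k n" "c + 1 / k n < T" using k by auto
    have I: "I \<subseteq> {0<..<T}" using kn c unfolding I_def by auto
    have close: "norm (y s - y c) \<le> e/2" if "s \<in> I" for s
    proof -
      have "1 / k n < d" using n0[OF \<open>n0 \<le> n\<close>] d(1) kn by (simp add: field_simps)
      then have "dist s c < d" using that unfolding I_def by (auto simp: dist_real_def)
      then show ?thesis using d(2)[of s] that I by (force simp: dist_norm)
    qed
    have \<rho>0: "\<rho> s = 0" if "s \<notin> I" for s
    proof -
      have "k n * (s - c) \<le> 0 \<or> 1 \<le> k n * (s - c)"
        using that kn unfolding I_def by (auto simp: field_simps mult_le_0_iff)
      then show ?thesis unfolding \<rho>_def using hat_eq_0 by auto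
    qed
    have \<rho>nn: "0 \<le> \<rho> s" for s unfolding \<rho>_def using kn hat_nonneg by simp
    have cont\<rho>: "continuous_on A \<rho>" for A unfolding \<rho>_def by (rule continuous_on_scaled_hat)
    have conty: "continuous_on I y" by (rule continuous_on_subset[OF y]) (use I in force)
    have "(\<rho> has_integral (smooth_step (k n * (c + 1/k n - c)) - smooth_step (k n * (c - c)))) I"
      unfolding I_def \<rho>_def
    proof (rule fundamental_theorem_of_calculus)
      show "((\<lambda>s. smooth_step (k n * (s - c))) has_vector_derivative k n * hat (k n * (s - c)))
          (at s within {c..c + 1/k n})" for s
        using scaled_smooth_step_derivative has_real_derivative_iff_has_vector_derivative
          has_vector_derivative_at_within by blast
    qed (use kn in simp)
    then have \<rho>1: "(\<rho> has_integral 1) I" using kn by (simp add: smooth_step_eq_0 smooth_step_eq_1)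
    have int: "(\<lambda>s. \<rho> s *\<^sub>R y s) integrable_on I" "(\<lambda>s. \<rho> s *\<^sub>R (y s - y c)) integrable_on I"
      unfolding I_def by (intro integrable_continuous_real continuous_intros cont\<rho> conty[unfolded I_def])+
    have "(LINT s|lebesgue_on {0<..<T}. \<rho> s *\<^sub>R y s) = (LINT s|lebesgue_on I. \<rho> s *\<^sub>R y s)"
      by (rule lebesgue_on_integral_superset[OF I]) (use \<rho>0 in \<open>auto simp: I_def\<close>)
    also have "\<dots> = integral I (\<lambda>s. \<rho> s *\<^sub>R y s)"
      unfolding I_def by (intro lebesgue_integral_eq_integral continuous_imp_integrable_real
          continuous_intros cont\<rho> conty[unfolded I_def]) auto
    finally have LHS: "(LINT s|lebesgue_on {0<..<T}. \<rho> s *\<^sub>R y s) = integral I (\<lambda>s. \<rho> s *\<^sub>R y s)" .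
    have "((\<lambda>s. \<rho> s *\<^sub>R y c) has_integral y c) I"
      using has_integral_scaleR_left[OF \<rho>1, of "y c"] by simp
    then have "((\<lambda>s. \<rho> s *\<^sub>R y s - \<rho> s *\<^sub>R y c) has_integral (integral I (\<lambda>s. \<rho> s *\<^sub>R y s) - y c)) I"
      by (intro has_integral_diff integrable_integral int)
    then have "integral I (\<lambda>s. \<rho> s *\<^sub>R y s) - y c = integral I (\<lambda>s. \<rho> s *\<^sub>R (y s - y c))"
      by (simp add: integral_unique scaleR_diff_right)
    also have "norm \<dots> \<le> integral I (\<lambda>s. \<rho> s * (e/2))"
    proof (rule integral_norm_bound_integral[OF int(2)])
      show "(\<lambda>s. \<rho> s * (e/2)) integrable_on I" using has_integral_mult_left[OF \<rho>1] by blast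
      show "norm (\<rho> s *\<^sub>R (y s - y c)) \<le> \<rho> s * (e/2)" if "s \<in> I" for s
        using mult_left_mono[OF close[OF that] \<rho>nn[of s]] \<rho>nn[of s] by simp
    qed
    also have "\<dots> = e/2" by (simp add: integral_unique[OF \<rho>1])
    finally have "norm ((LINT s|lebesgue_on {0<..<T}. \<rho> s *\<^sub>R y s) - y c) < e"
      unfolding LHS using \<open>0 < e\<close> by linarith
    then show "norm ((LINT s|lebesgue_on {0<..<T}. (k n * hat (k n * (s - c))) *\<^sub>R y s) - y c) < e"
      unfolding \<rho>_def .
  qed
qed

text \<open>
  Test the weak derivative against \<open>smooth_step(k(s - a)) - smooth_step(k(s - b))\<close>. As \<open>k\<close> grows, this
  tends to the indicator of \<open>{a<..b}\<close>, while its derivative tends to the difference of the Dirac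
  masses at \<open>a\<close> and \<open>b\<close>.
\<close>
lemma weak_derivative_imp_integral:
  fixes y v :: "real \<Rightarrow> 'a::euclidean_space"
  assumes y: "continuous_on {0..T} y"
    and v: "v \<in> borel_measurable lebesgue" "\<And>s. norm (v s) \<le> C"
    and weak: "weak_derivative T y v"
    and ab: "0 < a" "a < b" "b < T"
  shows "y b - y a = integral {a..b} v"
proof -
  \<comment> \<open>The rates start high enough for the supports to stay below \<open>T\<close>: each is at most \<open>(T - b)/2\<close> past \<open>b\<close>.\<close>
  define k where "k n = 2 / (T - b) + real n" for n
  have k0: "0 < 2 / (T - b)" "\<And>n. 2 / (T - b) \<le> k n" using ab by (auto simp: k_def)
  then have kpos: "\<And>n. 0 < k n" by (meson less_le_trans)
  have kinv: "1 / k n \<le> (T - b) / 2" for n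
    using divide_left_mono[OF k0(2)[of n], of 1] k0(1) kpos[of n] ab by (simp add: mult_pos_pos)
  have klim: "filterlim k at_top sequentially"
    unfolding k_def by (intro filterlim_tendsto_add_at_top[OF tendsto_const] filterlim_real_sequentially)
  define \<psi> where "\<psi> n s = smooth_step (k n * (s - a)) - smooth_step (k n * (s - b))" for n s
  define \<psi>' where "\<psi>' n s = k n * hat (k n * (s - a)) - k n * hat (k n * (s - b))" for n s
  let ?M = "lebesgue_on {0<..<T}"
  have test: "test_function T (\<psi> n) (\<psi>' n)" for n
    unfolding test_function_def
  proof (intro conjI allI exI impI)
    show "(\<psi> n has_real_derivative \<psi>' n s) (at s)" for s
      unfolding \<psi>_def[abs_def] \<psi>'_def by (intro DERIV_diff scaled_smooth_step_derivative)
    show "continuous_on UNIV (\<psi>' n)"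
      unfolding \<psi>'_def[abs_def] by (intro continuous_on_diff continuous_on_scaled_hat)
    show "0 < a" "(T + b) / 2 < T" using ab by auto
    fix s assume "s \<notin> {a..(T + b) / 2}"
    then consider "s < a" | "(T + b) / 2 < s" by force
    then show "\<psi> n s = 0"
    proof cases
      case 1
      then show ?thesis using kpos[of n] ab unfolding \<psi>_def
        by (simp add: smooth_step_eq_0 mult_nonneg_nonpos)
    next
      case 2
      then have "1 / k n \<le> s - b" using kinv[of n] by (auto simp: field_simps)
      then have "1 \<le> k n * (s - b)" using kpos[of n] by (simp add: field_simps)
      moreover have "k n * (s - b) \<le> k n * (s - a)" using kpos[of n] ab by simp
      ultimately show ?thesis unfolding \<psi>_def by (simp add: smooth_step_eq_1)
    qed
  qed
  have int: "integrable ?M (\<lambda>s. (k n * hat (k n * (s - c))) *\<^sub>R y s)" for n c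
    by (intro continuous_on_interval_integrable continuous_on_scaleR continuous_on_scaled_hat y)
  have "(\<lambda>n. LINT s|?M. \<psi>' n s *\<^sub>R y s) \<longlonglongrightarrow> y a - y b"
  proof -
    have inv: "1 / k n < T - b" "1 / k n < T - a" for n using kinv[of n] ab by (auto simp: field_simps)
    have "(\<lambda>n. (LINT s|?M. (k n * hat (k n * (s - a))) *\<^sub>R y s) - (LINT s|?M. (k n * hat (k n * (s - b))) *\<^sub>R y s))
        \<longlonglongrightarrow> y a - y b"
      by (intro tendsto_diff hat_averages_tendsto[OF y _ klim kpos]) (use inv ab in \<open>auto simp: algebra_simps\<close>)
    moreover have "(LINT s|?M. \<psi>' n s *\<^sub>R y s) =
        (LINT s|?M. (k n * hat (k n * (s - a))) *\<^sub>R y s) - (LINT s|?M. (k n * hat (k n * (s - b))) *\<^sub>R y s)" for n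
      unfolding \<psi>'_def scaleR_diff_left by (rule Bochner_Integration.integral_diff[OF int int])
    ultimately show ?thesis by simp
  qed
  moreover have "(LINT s|?M. \<psi>' n s *\<^sub>R y s) = - (LINT s|?M. \<psi> n s *\<^sub>R v s)" for n
    using weak test unfolding weak_derivative_def by blast
  moreover have lim: "(\<lambda>n. LINT s|?M. \<psi> n s *\<^sub>R v s) \<longlonglongrightarrow> (LINT s|?M. indicator {a<..b} s *\<^sub>R v s)"
  proof (rule integral_dominated_convergence)
    have vM: "v \<in> borel_measurable ?M" using v(1) by (rule measurable_restrict_space1)
    have c\<psi>: "continuous_on {0<..<T} (\<psi> n)" for n
      using test[of n] unfolding test_function_def
      by (meson DERIV_continuous_on DERIV_subset subset_UNIV)
    have "\<psi> n \<in> borel_measurable ?M" for n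
      by (rule continuous_imp_measurable_on_sets_lebesgue[OF c\<psi>]) auto
    then show "(\<lambda>s. \<psi> n s *\<^sub>R v s) \<in> borel_measurable ?M" for n
      using vM by (intro borel_measurable_scaleR)
    have "indicat_real {a<..b} \<in> borel_measurable ?M"
      by (intro measurable_restrict_space1 borel_measurable_indicator) auto
    then show "(\<lambda>s. indicat_real {a<..b} s *\<^sub>R v s) \<in> borel_measurable ?M"
      using vM by (intro borel_measurable_scaleR)
    show "integrable ?M (\<lambda>s. 2 * C)" by (rule continuous_on_interval_integrable) auto
    show "AE s in ?M. norm (\<psi> n s *\<^sub>R v s) \<le> 2 * C" for n
    proof (intro AE_I2)
      fix s
      have "\<bar>\<psi> n s\<bar> \<le> 2" unfolding \<psi>_def
        using smooth_step_bound[of "k n * (s - a)"] smooth_step_bound[of "k n * (s - b)"] by linarith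
      then show "norm (\<psi> n s *\<^sub>R v s) \<le> 2 * C" using v(2)[of s] by (auto intro!: mult_mono)
    qed
    have step: "eventually (\<lambda>n. smooth_step (k n * (s - c)) = indicator {c<..} s) sequentially" for s c
    proof (cases "c < s")
      case True
      have "eventually (\<lambda>n. 1 / (s - c) < k n) sequentially"
        using klim filterlim_at_top_dense by blast
      then show ?thesis
        by eventually_elim (use True in \<open>simp add: smooth_step_eq_1 field_simps\<close>)
    next
      case False
      then have "smooth_step (k n * (s - c)) = 0" for n
        using kpos[of n] by (intro smooth_step_eq_0) (auto simp: mult_nonneg_nonpos)
      then show ?thesis using False by simp
    qed
    show "AE s in ?M. (\<lambda>n. \<psi> n s *\<^sub>R v s) \<longlonglongrightarrow> indicator {a<..b} s *\<^sub>R v s"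
    proof (intro AE_I2 tendsto_eventually)
      fix s
      show "eventually (\<lambda>n. \<psi> n s *\<^sub>R v s = indicator {a<..b} s *\<^sub>R v s) sequentially"
        using step[of s a] step[of s b]
        by eventually_elim (use ab in \<open>auto simp: \<psi>_def indicator_def\<close>)
    qed
  qed
  ultimately have "y a - y b = - (LINT s|?M. indicator {a<..b} s *\<^sub>R v s)"
    using LIMSEQ_unique[OF _ tendsto_minus[OF lim]] by simp
  moreover have "(LINT s|?M. indicator {a<..b} s *\<^sub>R v s) = (LINT s|lebesgue_on {a<..b}. indicator {a<..b} s *\<^sub>R v s)"
    by (rule lebesgue_on_integral_superset) (use ab in auto)
  moreover have "\<dots> = (LINT s|lebesgue_on {a<..b}. v s)"
    by (rule Bochner_Integration.integral_cong) auto
  moreover have "\<dots> = integral {a<..b} v"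
    by (intro lebesgue_integral_eq_integral
        bounded_measurable_integrable[OF measurable_restrict_space1[OF v(1)] _ v(2)]
        bounded_set_imp_lmeasurable) auto
  moreover have "integral {a<..b} v = integral {a..b} v"
    by (rule integral_spike_set) (rule negligible_subset[of "{a}"], auto)+
  ultimately show ?thesis by (simp add: algebra_simps)
qed

text \<open>
  By the Lebesgue differentiation theorem a function is almost everywhere the limit of its averages
  over the intervals \<open>[s, s + h]\<close>; for the difference of \<open>v\<close> and \<open>w\<close> these averages vanish.
\<close>
lemma AE_eq_if_interval_integrals_eq:
  fixes v w :: "real \<Rightarrow> 'a::euclidean_space"
  assumes int: "\<And>a b. v integrable_on {a..b}" "\<And>a b. w integrable_on {a..b}"
    and eq: "\<And>a b. 0 < a \<Longrightarrow> a < b \<Longrightarrow> b < T \<Longrightarrow> integral {a..b} v = integral {a..b} w"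
  shows "AE s in lebesgue_on {0<..<T}. v s = w s"
proof -
  define f where "f s = v s - w s" for s
  have f_int: "f integrable_on cbox a b" for a b
    unfolding f_def using int by (auto intro!: integrable_diff)
  obtain N where N: "negligible N" and diff: "\<And>s e. s \<notin> N \<Longrightarrow> 0 < e \<Longrightarrow>
      \<exists>d>0. \<forall>h. 0 < h \<and> h < d \<longrightarrow> norm (integral (cbox s (s + h *\<^sub>R One)) f /\<^sub>R h ^ DIM(real) - f s) < e"
    using integrable_ccontinuous_explicit[of f, OF f_int] by metis
  show ?thesis
  proof (rule AE_lebesgue_onI[OF N])
    fix s assume s: "s \<in> {0<..<T}" "s \<notin> N"
    show "v s = w s"
    proof (rule ccontr)
      assume "v s \<noteq> w s"
      then have "0 < norm (f s)" by (simp add: f_def)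
      then obtain d where d: "0 < d" "\<And>h. 0 < h \<Longrightarrow> h < d \<Longrightarrow>
          norm (integral {s..s + h} f /\<^sub>R h - f s) < norm (f s)"
        using diff[OF s(2), of "norm (f s)"] by auto
      define h where "h = min (d/2) ((T - s)/2)"
      have h: "0 < h" "h < d" "s + h < T" using s d unfolding h_def by (auto simp: min_def field_simps)
      have "integral {s..s + h} f = 0"
        unfolding f_def using eq[of s "s + h"] h s int by (simp add: Henstock_Kurzweil_Integration.integral_diff)
      then show False using d(2)[OF h(1,2)] by simp
    qed
  qed auto
qed

text \<open>
  Changing \<open>v\<close> on a null set removes all exceptional points: the representative is measurable and
  bounded on the whole line, so that it can be integrated over every interval.
\<close>
lemma Linf_bounded_representative:
  fixes v :: "real \<Rightarrow> 'a::euclidean_space"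
  assumes "v \<in> Linf T"
  obtains w C where "w \<in> borel_measurable lebesgue" "\<And>s. norm (w s) \<le> C"
    "AE s in lebesgue_on {0<..<T}. w s = v s"
proof -
  obtain C where v: "v \<in> borel_measurable (lebesgue_on {0<..<T})"
    and C: "AE s in lebesgue_on {0<..<T}. norm (v s) \<le> C"
    using assms unfolding Linf_def by blast
  define w where "w s = (if s \<in> {0<..<T} then (if norm (v s) \<le> C then v s else 0) else 0)" for s
  have "(\<lambda>s. if norm (v s) \<le> C then v s else 0) \<in> borel_measurable (lebesgue_on {0<..<T})"
    using v by measurable
  then have "w \<in> borel_measurable lebesgue"
    unfolding w_def[abs_def] by (subst borel_measurable_if) auto
  moreover have "norm (w s) \<le> \<bar>C\<bar>" for s by (auto simp: w_def)
  moreover have "AE s in lebesgue_on {0<..<T}. s \<in> {0<..<T}"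
    by (rule AE_I2) simp
  with C have "AE s in lebesgue_on {0<..<T}. w s = v s"
    by eventually_elim (simp add: w_def)
  ultimately show ?thesis by (rule that)
qed

lemma bounded_measurable_integrable_on:
  fixes v :: "real \<Rightarrow> 'a::euclidean_space"
  assumes "v \<in> borel_measurable lebesgue" "\<And>s. norm (v s) \<le> C"
  shows "v integrable_on {a..b}"
proof (rule integrable_on_lebesgue_on)
  show "integrable (lebesgue_on {a..b}) v"
    by (rule bounded_measurable_integrable[OF measurable_restrict_space1[OF assms(1)] _ assms(2)]) simp
qed simp

lemma weak_derivative_cong_AE:
  fixes y v w :: "real \<Rightarrow> 'a::euclidean_space"
  assumes "weak_derivative T y v" "AE s in lebesgue_on {0<..<T}. w s = v s"
    and "v \<in> borel_measurable (lebesgue_on {0<..<T})" "w \<in> borel_measurable (lebesgue_on {0<..<T})"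
  shows "weak_derivative T y w"
  unfolding weak_derivative_def
proof (intro allI impI)
  fix \<psi> \<psi>' assume test: "test_function T \<psi> \<psi>'"
  have "continuous_on {0<..<T} \<psi>" using test unfolding test_function_def
      by (meson DERIV_continuous_on DERIV_subset subset_UNIV)
  then have \<psi>: "\<psi> \<in> borel_measurable (lebesgue_on {0<..<T})"
    by (rule continuous_imp_measurable_on_sets_lebesgue) auto
  have "(LINT s|lebesgue_on {0<..<T}. \<psi> s *\<^sub>R w s) = (LINT s|lebesgue_on {0<..<T}. \<psi> s *\<^sub>R v s)"
  proof (rule integral_cong_AE)
    show "AE s in lebesgue_on {0<..<T}. \<psi> s *\<^sub>R w s = \<psi> s *\<^sub>R v s"
      using assms(2) by eventually_elim simp
  qed (use assms \<psi> in \<open>auto intro: borel_measurable_scaleR\<close>)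
  then show "(LINT s|lebesgue_on {0<..<T}. \<psi>' s *\<^sub>R y s) = - (LINT s|lebesgue_on {0<..<T}. \<psi> s *\<^sub>R w s)"
    using assms(1) test unfolding weak_derivative_def by metis
qed

lemma weak_derivative_representative:
  fixes y v :: "real \<Rightarrow> 'a::euclidean_space"
  assumes y: "continuous_on {0..T} y" and v: "v \<in> Linf T" "weak_derivative T y v"
  obtains z C where "z \<in> borel_measurable lebesgue" "\<And>s. norm (z s) \<le> C"
    "AE s in lebesgue_on {0<..<T}. z s = v s"
    "\<And>a b. 0 < a \<Longrightarrow> a < b \<Longrightarrow> b < T \<Longrightarrow> y b - y a = integral {a..b} z"
proof -
  obtain z C where z: "z \<in> borel_measurable lebesgue" "\<And>s. norm (z s) \<le> C"
    "AE s in lebesgue_on {0<..<T}. z s = v s"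
    using Linf_bounded_representative[OF v(1)] by blast
  have "v \<in> borel_measurable (lebesgue_on {0<..<T})" using v(1) by (simp add: Linf_def)
  then have "weak_derivative T y z"
    using weak_derivative_cong_AE[OF v(2) z(3)] measurable_restrict_space1[OF z(1)] by blast
  then have "\<And>a b. 0 < a \<Longrightarrow> a < b \<Longrightarrow> b < T \<Longrightarrow> y b - y a = integral {a..b} z"
    using weak_derivative_imp_integral[OF y z(1,2)] by blast
  with z show ?thesis by (rule that)
qed

lemma weak_derivative_unique:
  fixes y v w :: "real \<Rightarrow> 'a::euclidean_space"
  assumes y: "continuous_on {0..T} y" and v: "v \<in> Linf T" "weak_derivative T y v"
    and w: "w \<in> Linf T" "weak_derivative T y w"
  shows "AE s in lebesgue_on {0<..<T}. v s = w s"
proof -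
  obtain z1 C1 where z1: "z1 \<in> borel_measurable lebesgue" "\<And>s. norm (z1 s) \<le> C1"
    "AE s in lebesgue_on {0<..<T}. z1 s = v s"
    "\<And>a b. 0 < a \<Longrightarrow> a < b \<Longrightarrow> b < T \<Longrightarrow> y b - y a = integral {a..b} z1"
    using weak_derivative_representative[OF y v] by blast
  obtain z2 C2 where z2: "z2 \<in> borel_measurable lebesgue" "\<And>s. norm (z2 s) \<le> C2"
    "AE s in lebesgue_on {0<..<T}. z2 s = w s"
    "\<And>a b. 0 < a \<Longrightarrow> a < b \<Longrightarrow> b < T \<Longrightarrow> y b - y a = integral {a..b} z2"
    using weak_derivative_representative[OF y w] by blast
  have "AE s in lebesgue_on {0<..<T}. z1 s = z2 s"
  proof (rule AE_eq_if_interval_integrals_eq)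
    show "z1 integrable_on {a..b}" for a b by (rule bounded_measurable_integrable_on[OF z1(1,2)])
    show "z2 integrable_on {a..b}" for a b by (rule bounded_measurable_integrable_on[OF z2(1,2)])
    show "integral {a..b} z1 = integral {a..b} z2" if "0 < a" "a < b" "b < T" for a b
      using z1(4)[OF that] z2(4)[OF that] by simp
  qed
  with z1(3) z2(3) show ?thesis by eventually_elim simp
qed

section \<open>The chain rule for weak derivatives\<close>

lemma measurable_blinfun_apply_continuous:
  fixes A :: "real \<Rightarrow> 'a::euclidean_space \<Rightarrow>\<^sub>L 'b::euclidean_space" and v :: "real \<Rightarrow> 'a"
  assumes A: "continuous_on S A" and S: "S \<in> sets lebesgue" and v: "v \<in> borel_measurable (lebesgue_on S)"
  shows "(\<lambda>s. blinfun_apply (A s) (v s)) \<in> borel_measurable (lebesgue_on S)"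
proof -
  have "blinfun_apply (A s) (v s) = (\<Sum>i\<in>Basis. (v s \<bullet> i) *\<^sub>R blinfun_apply (A s) i)" for s
    by (subst euclidean_representation[of "v s", symmetric])
       (simp only: blinfun.sum_right blinfun.scaleR_right)
  moreover have "(\<lambda>s. blinfun_apply (A s) i) \<in> borel_measurable (lebesgue_on S)" for i
    by (rule continuous_imp_measurable_on_sets_lebesgue[OF _ S]) (intro continuous_intros A)
  ultimately show ?thesis
    using v by (simp only:) (intro borel_measurable_sum borel_measurable_scaleR borel_measurable_inner, auto)
qed

text \<open>
  The chain rule for Lipschitz functions. If \<open>v\<close> is continuous, then \<open>y\<close> is continuously
  differentiable and \<open>\<psi> g(y)\<close>, which vanishes at both ends of an interval around the support of
  \<open>\<psi>\<close>, has a derivative with integral 0. In general, approximate \<open>v\<close> almost everywhere by uniformly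
  bounded continuous functions. Their primitives converge pointwise to \<open>y\<close>, and dominated
  convergence carries the identity to the limit.
\<close>
lemma weak_derivative_compose_bounded:
  fixes y v :: "real \<Rightarrow> 'a::euclidean_space" and g :: "'a \<Rightarrow> 'b::euclidean_space"
    and g' :: "'a \<Rightarrow> 'a \<Rightarrow>\<^sub>L 'b"
  assumes T: "0 < T" and y: "continuous_on {0..T} y"
    and v: "v \<in> borel_measurable lebesgue" "\<And>s. norm (v s) \<le> C"
    and ftc: "\<And>a b. 0 < a \<Longrightarrow> a < b \<Longrightarrow> b < T \<Longrightarrow> y b - y a = integral {a..b} v"
    and g: "\<And>z. (g has_derivative blinfun_apply (g' z)) (at z)" "continuous_on UNIV g'"
  shows "weak_derivative T (\<lambda>s. g (y s)) (\<lambda>s. blinfun_apply (g' (y s)) (v s))"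
  unfolding weak_derivative_def
proof (intro allI impI)
  fix \<psi> \<psi>' assume "test_function T \<psi> \<psi>'"
  then obtain a0 b0 where \<psi>: "\<And>s. (\<psi> has_real_derivative \<psi>' s) (at s)" "continuous_on UNIV \<psi>'"
    and ab0: "0 < a0" "b0 < T" and supp: "\<And>s. s \<notin> {a0..b0} \<Longrightarrow> \<psi> s = 0"
    unfolding test_function_def by blast
  \<comment> \<open>A nonempty interval that contains the support of \<open>\<psi>\<close> in its interior, even if \<open>a0 > b0\<close>.\<close>
  define a where "a = min a0 (T/3) / 2"
  define b where "b = (max b0 (2*T/3) + T) / 2"
  have ab: "0 < a" "a < b" "b < T" "a < a0" "b0 < b"
    using ab0 T unfolding a_def b_def by (auto simp: min_def max_def field_simps)
  let ?I = "{a..b}"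
  let ?M = "lebesgue_on {a..b}"
  have \<psi>0: "\<psi> s = 0" if "s \<le> a \<or> b \<le> s" for s using supp[of s] that ab by auto
  have \<psi>'0: "\<psi>' s = 0" if "s \<notin> ?I" for s
  proof -
    have "eventually (\<lambda>r. r \<in> - ?I) (nhds s)" using that by (intro eventually_nhds_in_open) auto
    then have "eventually (\<lambda>r. \<psi> r = 0) (nhds s)" by eventually_elim (use \<psi>0 in auto)
    then have "((\<lambda>_. 0) has_real_derivative \<psi>' s) (at s)"
      using \<psi>(1)[of s] by (subst (asm) DERIV_cong_ev[OF refl _ refl]) auto
    then show ?thesis using DERIV_unique DERIV_const by blast
  qed
  have cont\<psi>: "continuous_on A \<psi>" "continuous_on A \<psi>'" for A
    using \<psi> by (auto intro: DERIV_continuous_on DERIV_subset continuous_on_subset)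
  have contg: "continuous_on A g" for A
    using g(1) by (meson has_derivative_at_withinI has_derivative_continuous_on)
  have conty: "continuous_on ?I y" by (rule continuous_on_subset[OF y]) (use ab in auto)
  have C: "0 \<le> C" using v(2)[of 0] norm_ge_zero order_trans by blast

  have "v measurable_on UNIV" using v(1) by (simp add: lebesgue_measurable_imp_measurable_on)
  then obtain N vv where N: "negligible N" and vv: "\<And>n. continuous_on UNIV (vv n)"
    and vv_lim: "\<And>s. s \<notin> N \<Longrightarrow> (\<lambda>n. vv n s) \<longlonglongrightarrow> v s"
    unfolding measurable_on_def by auto
  \<comment> \<open>Projecting onto the ball that contains the values of \<open>v\<close> preserves continuity and the limit.\<close>
  define w where "w n s = closest_point (cball 0 C) (vv n s)" for n :: nat and s
  have ball: "cball (0::'a) C \<noteq> {}" using C by simp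
  have cont_cp: "continuous_on A (closest_point (cball (0::'a) C))" for A
    by (rule continuous_on_closest_point) (use ball in auto)
  have w: "continuous_on A (w n)" for n A
    unfolding w_def by (rule continuous_on_compose2[OF cont_cp[of UNIV] continuous_on_subset[OF vv]]) auto
  have wC: "norm (w n s) \<le> C" for n s
    using closest_point_in_set[of "cball (0::'a) C" "vv n s"] ball unfolding w_def by auto
  have w_lim: "(\<lambda>n. w n s) \<longlonglongrightarrow> v s" if "s \<notin> N" for s
  proof -
    have "(\<lambda>n. closest_point (cball 0 C) (vv n s)) \<longlonglongrightarrow> closest_point (cball 0 C) (v s)"
      by (rule continuous_on_tendsto_compose[OF cont_cp[of UNIV] vv_lim[OF that]]) auto
    moreover have "closest_point (cball 0 C) (v s) = v s"
      by (rule closest_point_self) (use v(2)[of s] in auto)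
    ultimately show ?thesis unfolding w_def by simp
  qed

  define Y where "Y n s = y a + integral {a..s} (w n)" for n s
  have Y_deriv: "(Y n has_vector_derivative w n s) (at s within ?I)" if "s \<in> ?I" for n s
    unfolding Y_def[abs_def]
    using has_vector_derivative_add[OF has_vector_derivative_const integral_has_vector_derivative[OF w that]]
    by simp
  have Y_bound: "Y n s \<in> cball (y a) (C * (b - a))" if s: "s \<in> ?I" for n s
  proof -
    have "norm (integral {a..s} (w n)) \<le> C * (s - a)"
      by (rule integral_bound) (use s wC w in auto)
    also have "\<dots> \<le> C * (b - a)" using s C by (intro mult_left_mono) auto
    finally show ?thesis unfolding Y_def by (simp add: dist_norm)
  qed
  have Y_lim: "(\<lambda>n. Y n s) \<longlonglongrightarrow> y s" if s: "s \<in> ?I" for s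
  proof -
    have sub: "integrable (lebesgue_on {a..s}) f \<Longrightarrow> (LINT r|lebesgue_on {a..s}. f r) = integral {a..s} f"
      for f :: "real \<Rightarrow> 'a" by (rule lebesgue_integral_eq_integral) auto
    have int_v: "integrable (lebesgue_on {a..s}) v"
      by (rule bounded_measurable_integrable[OF measurable_restrict_space1[OF v(1)] _ v(2)]) simp
    have "(\<lambda>n. LINT r|lebesgue_on {a..s}. w n r) \<longlonglongrightarrow> (LINT r|lebesgue_on {a..s}. v r)"
    proof (rule integral_dominated_convergence)
      show "v \<in> borel_measurable (lebesgue_on {a..s})" using v(1) by (rule measurable_restrict_space1)
      show "w n \<in> borel_measurable (lebesgue_on {a..s})" for n
        by (rule continuous_imp_measurable_on_sets_lebesgue[OF w]) auto
      show "integrable (lebesgue_on {a..s}) (\<lambda>_. C)" by (intro continuous_imp_integrable_real) auto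
      show "AE r in lebesgue_on {a..s}. (\<lambda>n. w n r) \<longlonglongrightarrow> v r"
        by (rule AE_lebesgue_onI[OF N]) (use w_lim in auto)
      show "AE r in lebesgue_on {a..s}. norm (w n r) \<le> C" for n using wC by (intro AE_I2)
    qed
    then have "(\<lambda>n. integral {a..s} (w n)) \<longlonglongrightarrow> integral {a..s} v"
      by (simp only: sub[OF int_v] sub[OF continuous_imp_integrable_real[OF w]])
    moreover have "integral {a..s} v = y s - y a"
    proof (cases "a < s")
      case True
      then show ?thesis using ftc[of a s] s ab by auto
    next
      case False
      then show ?thesis using s by simp
    qed
    ultimately have "(\<lambda>n. y a + integral {a..s} (w n)) \<longlonglongrightarrow> y a + (y s - y a)"
      by (intro tendsto_intros) simp
    then show ?thesis unfolding Y_def by simp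
  qed

  \<comment> \<open>The derivative of \<open>\<psi> g(Y n)\<close>, and its limit; the former integrates to 0.\<close>
  define F where "F n s = \<psi>' s *\<^sub>R g (Y n s) + \<psi> s *\<^sub>R blinfun_apply (g' (Y n s)) (w n s)" for n s
  define F1 where "F1 s = \<psi>' s *\<^sub>R g (y s)" for s
  define F2 where "F2 s = \<psi> s *\<^sub>R blinfun_apply (g' (y s)) (v s)" for s
  have contY: "continuous_on ?I (Y n)" for n
    by (rule continuous_on_vector_derivative) (rule Y_deriv)
  have contF: "continuous_on ?I (F n)" for n
    unfolding F_def
    by (intro continuous_intros cont\<psi> w contY continuous_on_compose2[OF contg[of UNIV] contY]
        continuous_on_compose2[OF g(2) contY]) auto
  have F_zero: "(LINT s|?M. F n s) = 0" for n
  proof -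
    have "(F n has_integral \<psi> b *\<^sub>R g (Y n b) - \<psi> a *\<^sub>R g (Y n a)) ?I"
    proof (rule fundamental_theorem_of_calculus)
      fix s assume s: "s \<in> ?I"
      have "((g \<circ> Y n) has_vector_derivative blinfun_apply (g' (Y n s)) (w n s)) (at s within ?I)"
        by (rule vector_derivative_diff_chain_within[OF Y_deriv[OF s]])
           (rule has_derivative_at_withinI[OF g(1)])
      then have "((\<lambda>s. g (Y n s)) has_vector_derivative blinfun_apply (g' (Y n s)) (w n s)) (at s within ?I)"
        by (simp add: comp_def)
      from has_vector_derivative_scaleR[OF has_field_derivative_at_within[OF \<psi>(1)] this]
      show "((\<lambda>s. \<psi> s *\<^sub>R g (Y n s)) has_vector_derivative F n s) (at s within ?I)"
        unfolding F_def by (simp add: add.commute)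
    qed (use ab in auto)
    then have "integral ?I (F n) = 0" using \<psi>0[of a] \<psi>0[of b] by (simp add: integral_unique)
    then show ?thesis
      using lebesgue_integral_eq_integral[OF continuous_imp_integrable_real[OF contF[of n]]] by simp
  qed
  have compact_bound: "\<exists>B. \<forall>z\<in>K. norm (f z) \<le> B" if "compact K" "continuous_on K f"
    for K :: "'c::topological_space set" and f :: "'c \<Rightarrow> 'd::real_normed_vector"
    using compact_imp_bounded[OF compact_continuous_image[OF that(2,1)]] by (auto simp: bounded_iff)
  have contg'y: "continuous_on ?I (\<lambda>s. g' (y s))"
    by (rule continuous_on_compose2[OF g(2) conty]) auto
  have vM: "v \<in> borel_measurable ?M" using v(1) by (rule measurable_restrict_space1)
  have measF1: "F1 \<in> borel_measurable ?M"
    unfolding F1_def by (rule continuous_imp_measurable_on_sets_lebesgue)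
      (intro continuous_intros cont\<psi> continuous_on_compose2[OF contg[of UNIV] conty], auto)
  have "\<psi> \<in> borel_measurable ?M" by (rule continuous_imp_measurable_on_sets_lebesgue[OF cont\<psi>(1)]) auto
  then have measF2: "F2 \<in> borel_measurable ?M"
    unfolding F2_def by (intro borel_measurable_scaleR measurable_blinfun_apply_continuous contg'y vM) auto
  obtain P where P: "\<And>s. s \<in> ?I \<Longrightarrow> norm (\<psi> s) \<le> P"
    using compact_bound[OF compact_Icc cont\<psi>(1)] by blast
  obtain P' where P': "\<And>s. s \<in> ?I \<Longrightarrow> norm (\<psi>' s) \<le> P'"
    using compact_bound[OF compact_Icc cont\<psi>(2)] by blast
  obtain G where G: "\<And>z. z \<in> cball (y a) (C * (b - a)) \<Longrightarrow> norm (g z) \<le> G"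
    using compact_bound[OF compact_cball contg] by blast
  obtain G' where G': "\<And>z. z \<in> cball (y a) (C * (b - a)) \<Longrightarrow> norm (g' z) \<le> G'"
    using compact_bound[OF compact_cball continuous_on_subset[OF g(2)]] by blast
  have bound: "norm (p *\<^sub>R g z) \<le> P' * G" "norm (q *\<^sub>R blinfun_apply (g' z) x) \<le> P * (G' * C)"
    if "norm p \<le> P'" "norm q \<le> P" "z \<in> cball (y a) (C * (b - a))" "norm x \<le> C" for p q :: real and z x
  proof -
    show "norm (p *\<^sub>R g z) \<le> P' * G"
      unfolding norm_scaleR using that G[OF that(3)] norm_ge_zero by (intro mult_mono) (auto intro: order_trans)
    have "norm (blinfun_apply (g' z) x) \<le> norm (g' z) * norm x" by (rule norm_blinfun)
    also have "\<dots> \<le> G' * C" using that G'[OF that(3)] C by (intro mult_mono) (auto intro: order_trans[OF norm_ge_zero])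
    finally show "norm (q *\<^sub>R blinfun_apply (g' z) x) \<le> P * (G' * C)"
      unfolding norm_scaleR using that by (intro mult_mono) (auto intro: order_trans[OF abs_ge_zero])
  qed
  have y_ball: "y s \<in> cball (y a) (C * (b - a))" if "s \<in> ?I" for s
    using Lim_in_closed_set[OF closed_cball _ _ Y_lim[OF that]] Y_bound[OF that] by simp
  have "(\<lambda>n. LINT s|?M. F n s) \<longlonglongrightarrow> (LINT s|?M. F1 s + F2 s)"
  proof (rule integral_dominated_convergence)
    show "(\<lambda>s. F1 s + F2 s) \<in> borel_measurable ?M" using measF1 measF2 by (rule borel_measurable_add)
    show "F n \<in> borel_measurable ?M" for n
      by (rule continuous_imp_measurable_on_sets_lebesgue[OF contF]) auto
    show "integrable ?M (\<lambda>_. P' * G + P * (G' * C))" by (intro continuous_imp_integrable_real) auto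
    show "AE s in ?M. norm (F n s) \<le> P' * G + P * (G' * C)" for n
      unfolding F_def
      by (intro AE_I2 norm_triangle_le add_mono bound) (use P P' Y_bound wC in auto)
    show "AE s in ?M. (\<lambda>n. F n s) \<longlonglongrightarrow> F1 s + F2 s"
    proof (rule AE_lebesgue_onI[OF N])
      fix s assume s: "s \<in> ?I" "s \<notin> N"
      have "(\<lambda>n. g (Y n s)) \<longlonglongrightarrow> g (y s)" "(\<lambda>n. g' (Y n s)) \<longlonglongrightarrow> g' (y s)"
        by (rule continuous_on_tendsto_compose[OF contg[of UNIV] Y_lim[OF s(1)]]
            continuous_on_tendsto_compose[OF g(2) Y_lim[OF s(1)]]; simp)+
      then show "(\<lambda>n. F n s) \<longlonglongrightarrow> F1 s + F2 s"
        unfolding F_def F1_def F2_def by (intro tendsto_intros w_lim s)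
    qed auto
  qed
  then have sum0: "(LINT s|?M. F1 s + F2 s) = 0"
    unfolding F_zero LIMSEQ_const_iff by (rule sym)
  have intF1: "integrable ?M F1"
  proof (rule bounded_measurable_integrable[OF measF1])
    show "norm (F1 s) \<le> P' * G" if "s \<in> ?I" for s
      unfolding F1_def by (rule bound(1)[OF P'[OF that] P[OF that] y_ball[OF that] v(2)])
  qed simp
  have intF2: "integrable ?M F2"
  proof (rule bounded_measurable_integrable[OF measF2])
    show "norm (F2 s) \<le> P * (G' * C)" if "s \<in> ?I" for s
      unfolding F2_def by (rule bound(2)[OF P'[OF that] P[OF that] y_ball[OF that] v(2)])
  qed simp
  have "(LINT s|lebesgue_on {0<..<T}. F1 s) = (LINT s|?M. F1 s)"
    by (rule lebesgue_on_integral_superset) (use ab \<psi>'0 in \<open>auto simp: F1_def\<close>)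
  moreover have "(LINT s|lebesgue_on {0<..<T}. F2 s) = (LINT s|?M. F2 s)"
    by (rule lebesgue_on_integral_superset) (use ab \<psi>0 in \<open>auto simp: F2_def\<close>)
  moreover have "(LINT s|?M. F1 s) + (LINT s|?M. F2 s) = 0"
    using sum0 Bochner_Integration.integral_add[OF intF1 intF2] by simp
  ultimately show "(LINT s|lebesgue_on {0<..<T}. \<psi>' s *\<^sub>R g (y s))
      = - (LINT s|lebesgue_on {0<..<T}. \<psi> s *\<^sub>R blinfun_apply (g' (y s)) (v s))"
    unfolding F1_def[abs_def] F2_def[abs_def] by (simp add: eq_neg_iff_add_eq_0)
qed

lemma ddt_works:
  assumes "y \<in> W1inf T"
  shows "ddt T y \<in> Linf T" "weak_derivative T y (ddt T y)"
proof -
  have "\<exists>v. v \<in> Linf T \<and> weak_derivative T y v" using assms unfolding W1inf_def by blast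
  from someI_ex[OF this] show "ddt T y \<in> Linf T" "weak_derivative T y (ddt T y)"
    unfolding ddt_def by auto
qed

lemma compact_image_norm_bound:
  fixes f :: "'c::topological_space \<Rightarrow> 'd::real_normed_vector"
  assumes "compact K" "continuous_on K f"
  obtains B where "\<And>z. z \<in> K \<Longrightarrow> norm (f z) \<le> B"
  using compact_imp_bounded[OF compact_continuous_image[OF assms(2,1)]] by (auto simp: bounded_iff)

lemma continuous_on_imp_Linf:
  fixes y :: "real \<Rightarrow> 'a::euclidean_space"
  assumes "continuous_on {0..T} y"
  shows "y \<in> Linf T"
proof -
  have "y \<in> borel_measurable (lebesgue_on {0<..<T})"
    using continuous_on_interval_integrable[OF assms] by (rule borel_measurable_integrable)
  moreover obtain B where "\<And>s. s \<in> {0..T} \<Longrightarrow> norm (y s) \<le> B"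
    using compact_image_norm_bound[OF compact_Icc assms] by blast
  then have "AE s in lebesgue_on {0<..<T}. norm (y s) \<le> B" by (intro AE_I2) auto
  ultimately show ?thesis unfolding Linf_def by blast
qed

lemma W1inf_compose:
  fixes y :: "real \<Rightarrow> 'a::euclidean_space" and g :: "'a \<Rightarrow> 'b::euclidean_space"
    and g' :: "'a \<Rightarrow> 'a \<Rightarrow>\<^sub>L 'b"
  assumes T: "0 < T" and y: "y \<in> W1inf T"
    and g: "\<And>z. (g has_derivative blinfun_apply (g' z)) (at z)" "continuous_on UNIV g'"
  shows "(\<lambda>s. g (y s)) \<in> W1inf T"
    and "AE s in lebesgue_on {0<..<T}. ddt T (\<lambda>s. g (y s)) s = blinfun_apply (g' (y s)) (ddt T y s)"
proof -
  have cont: "continuous_on {0..T} y" using y by (simp add: W1inf_def)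
  obtain z C where z: "z \<in> borel_measurable lebesgue" "\<And>s. norm (z s) \<le> C"
    "AE s in lebesgue_on {0<..<T}. z s = ddt T y s"
    "\<And>a b. 0 < a \<Longrightarrow> a < b \<Longrightarrow> b < T \<Longrightarrow> y b - y a = integral {a..b} z"
    using weak_derivative_representative[OF cont ddt_works[OF y]] by blast
  define G where "G s = blinfun_apply (g' (y s)) (z s)" for s
  have weak: "weak_derivative T (\<lambda>s. g (y s)) G"
    unfolding G_def by (rule weak_derivative_compose_bounded[OF T cont z(1,2,4) g])
  have cont_g': "continuous_on {0..T} (\<lambda>s. g' (y s))"
    by (rule continuous_on_compose2[OF g(2) cont]) auto
  have "G \<in> borel_measurable (lebesgue_on {0<..<T})"
    unfolding G_def
  proof (rule measurable_blinfun_apply_continuous)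
    show "continuous_on {0<..<T} (\<lambda>s. g' (y s))" by (rule continuous_on_subset[OF cont_g']) auto
  qed (use z(1) in \<open>auto intro: measurable_restrict_space1\<close>)
  moreover obtain B where B: "\<And>s. s \<in> {0..T} \<Longrightarrow> norm (g' (y s)) \<le> B"
    using compact_image_norm_bound[OF compact_Icc cont_g'] by blast
  have "norm (G s) \<le> B * C" if "s \<in> {0..T}" for s
  proof -
    have "norm (G s) \<le> norm (g' (y s)) * norm (z s)" unfolding G_def by (rule norm_blinfun)
    also have "\<dots> \<le> B * C"
      using B[OF that] z(2)[of s] by (intro mult_mono) (auto intro: order_trans[OF norm_ge_zero])
    finally show ?thesis .
  qed
  then have "AE s in lebesgue_on {0<..<T}. norm (G s) \<le> B * C" by (intro AE_I2) auto
  ultimately have G: "G \<in> Linf T" unfolding Linf_def by blast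
  have cont_gy: "continuous_on {0..T} (\<lambda>s. g (y s))"
  proof (rule continuous_on_compose2[OF _ cont])
    show "continuous_on UNIV g"
      using g(1) by (meson has_derivative_at_withinI has_derivative_continuous_on)
  qed auto
  show W: "(\<lambda>s. g (y s)) \<in> W1inf T"
    unfolding W1inf_def using cont_gy continuous_on_imp_Linf[OF cont_gy] weak G by auto
  have "AE s in lebesgue_on {0<..<T}. ddt T (\<lambda>s. g (y s)) s = G s"
    by (rule weak_derivative_unique[OF cont_gy ddt_works[OF W] G weak])
  with z(3) show "AE s in lebesgue_on {0<..<T}. ddt T (\<lambda>s. g (y s)) s = blinfun_apply (g' (y s)) (ddt T y s)"
    by eventually_elim (simp add: G_def)
qed

section \<open>One-sided derivatives at a maximum\<close>

lemma W1inf_increment_le: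
  fixes y :: "real \<Rightarrow> real"
  assumes y: "y \<in> W1inf T" and ab: "0 < a" "a < b" "b < T"
    and bound: "AE s in lebesgue_on {0<..<T}. a < s \<and> s < b \<longrightarrow> ddt T y s \<le> c"
  shows "y b - y a \<le> c * (b - a)"
proof -
  have cont: "continuous_on {0..T} y" using y by (simp add: W1inf_def)
  obtain z C where z: "z \<in> borel_measurable lebesgue" "\<And>s. norm (z s) \<le> C"
    "AE s in lebesgue_on {0<..<T}. z s = ddt T y s"
    "\<And>a b. 0 < a \<Longrightarrow> a < b \<Longrightarrow> b < T \<Longrightarrow> y b - y a = integral {a..b} z"
    using weak_derivative_representative[OF cont ddt_works[OF y]] by blast
  have int: "integrable (lebesgue_on {a..b}) z"
    by (rule bounded_measurable_integrable[OF measurable_restrict_space1[OF z(1)] _ z(2)]) simp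
  have intc: "integrable (lebesgue_on {a..b}) (\<lambda>_. c)" by (intro continuous_imp_integrable_real) auto
  have "y b - y a = (LINT s|lebesgue_on {a..b}. z s)"
    using z(4)[OF ab] lebesgue_integral_eq_integral[OF int] by simp
  also have "\<dots> \<le> (LINT s|lebesgue_on {a..b}. c)"
  proof (rule integral_mono_AE[OF int intc])
    have "AE s in lebesgue_on {0<..<T}. a < s \<and> s < b \<longrightarrow> z s \<le> c"
      using z(3) bound by eventually_elim simp
    then have 1: "AE s in lebesgue_on {a..b}. a < s \<and> s < b \<longrightarrow> z s \<le> c"
      by (rule AE_lebesgue_on_subset) (use ab in auto)
    have 2: "AE s in lebesgue_on {a..b}. a < s \<and> s < b"
      by (rule AE_lebesgue_onI[of "{a, b}"]) auto
    show "AE s in lebesgue_on {a..b}. z s \<le> c" using 1 2 by eventually_elim simp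
  qed
  also have "\<dots> = c * (b - a)"
    using lebesgue_integral_eq_integral[OF intc] ab by simp
  finally show ?thesis .
qed

text \<open>
  This is the previous bound for \<open>- y\<close>, whose derivative comes from the chain rule.
\<close>
lemma W1inf_increment_ge:
  fixes y :: "real \<Rightarrow> real"
  assumes y: "y \<in> W1inf T" and T: "0 < T" and ab: "0 < a" "a < b" "b < T"
    and bound: "AE s in lebesgue_on {0<..<T}. a < s \<and> s < b \<longrightarrow> c \<le> ddt T y s"
  shows "c * (b - a) \<le> y b - y a"
proof -
  have neg: "(uminus has_derivative blinfun_apply (- id_blinfun)) (at z)" for z :: real
    by (auto intro!: derivative_eq_intros simp: blinfun.minus_left)
  note W = W1inf_compose[OF T y neg continuous_on_const]
  have "AE s in lebesgue_on {0<..<T}. a < s \<and> s < b \<longrightarrow> ddt T (\<lambda>s. - y s) s \<le> - c"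
    using bound W(2) by eventually_elim (simp add: blinfun.minus_left)
  from W1inf_increment_le[OF W(1) ab this] show ?thesis by simp
qed

text \<open>
  If the left limit \<open>l\<close> of the derivative were negative, \<open>y\<close> would decrease towards \<open>t\<close> at a rate of at
  least \<open>- l/2\<close>, so it would be larger than \<open>y t\<close> just before \<open>t\<close>; the right limit is similar.
\<close>
lemma max_one_sided_derivatives:
  fixes y :: "real \<Rightarrow> real"
  assumes y: "y \<in> W1inf T" and t: "0 < t" "t < T"
    and w: "AE s in lebesgue_on {0<..<T}. ddt T y s = w s"
    and max: "\<And>s. s \<in> {0..T} \<Longrightarrow> y s \<le> y t"
  shows "(w \<longlongrightarrow> l) (at_left t) \<Longrightarrow> 0 \<le> l" and "(w \<longlongrightarrow> r) (at_right t) \<Longrightarrow> r \<le> 0"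
proof -
  show "0 \<le> l" if lim: "(w \<longlongrightarrow> l) (at_left t)"
  proof (rule ccontr)
    assume "\<not> 0 \<le> l"
    then have "eventually (\<lambda>s. w s < l/2) (at_left t)" using lim by (intro order_tendstoD) auto
    then obtain b where b: "b < t" "\<And>s. b < s \<Longrightarrow> s < t \<Longrightarrow> w s < l/2"
      unfolding eventually_at_left[OF t(1)] by auto
    define a where "a = max b (t/2)"
    have a: "0 < a" "a < t" "b \<le> a" using b t by (auto simp: a_def)
    have "AE s in lebesgue_on {0<..<T}. a < s \<and> s < t \<longrightarrow> ddt T y s \<le> l/2"
      using w by eventually_elim (use a b(2) in \<open>auto intro: less_imp_le\<close>)
    from W1inf_increment_le[OF y a(1,2) t(2) this] have "y t - y a \<le> l/2 * (t - a)" .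
    moreover have "l/2 * (t - a) < 0" using \<open>\<not> 0 \<le> l\<close> a by (intro mult_neg_pos) auto
    moreover have "y a \<le> y t" using a t by (intro max) auto
    ultimately show False by linarith
  qed
  show "r \<le> 0" if lim: "(w \<longlongrightarrow> r) (at_right t)"
  proof (rule ccontr)
    assume "\<not> r \<le> 0"
    then have "eventually (\<lambda>s. r/2 < w s) (at_right t)" using lim by (intro order_tendstoD) auto
    then obtain b where b: "t < b" "\<And>s. t < s \<Longrightarrow> s < b \<Longrightarrow> r/2 < w s"
      unfolding eventually_at_right[OF t(2)] by auto
    define a where "a = min b ((t + T)/2)"
    have a: "t < a" "a < T" "a \<le> b" using b t by (auto simp: a_def min_def field_simps)
    have "AE s in lebesgue_on {0<..<T}. t < s \<and> s < a \<longrightarrow> r/2 \<le> ddt T y s"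
      using w by eventually_elim (use a b(2) in \<open>auto intro: less_imp_le\<close>)
    from W1inf_increment_ge[OF y _ t(1) a(1,2) this] have "r/2 * (a - t) \<le> y a - y t" using t by auto
    moreover have "0 < r/2 * (a - t)" using \<open>\<not> r \<le> 0\<close> a by (intro mult_pos_pos) auto
    moreover have "y a \<le> y t" using a t by (intro max) auto
    ultimately show False by linarith
  qed
qed

section \<open>Minimality on both sides of a jump\<close>

lemma AE_interval_meets:
  fixes T a b :: real
  assumes "AE s in lebesgue_on {0<..<T}. P s" "0 \<le> a" "a < b" "b \<le> T"
  shows "\<exists>s. a < s \<and> s < b \<and> P s"
proof (rule ccontr)
  assume no: "\<nexists>s. a < s \<and> s < b \<and> P s"
  have "AE s in lebesgue. s \<in> {0<..<T} \<longrightarrow> P s" using assms(1) by (simp add: AE_restrict_space_iff)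
  then have "AE s in lebesgue. s \<notin> {a<..<b}" by eventually_elim (use no assms in auto)
  then have "{a<..<b} \<in> null_sets lebesgue" by (subst AE_iff_null_sets) auto
  then have "negligible {a<..<b}" by (simp add: negligible_iff_null_sets)
  then show False using open_not_negligible[of "{a<..<b}"] assms by auto
qed

text \<open>
  This makes one-sided limits of functions known only almost everywhere usable: an inequality that
  holds almost everywhere holds at points arbitrarily close to \<open>t\<close> on each side, hence passes to the
  one-sided limits.
\<close>
lemma AE_frequently_one_sided:
  fixes T t :: real
  assumes P: "AE s in lebesgue_on {0<..<T}. P s" and t: "0 < t" "t < T"
  shows "frequently P (at_left t)" "frequently P (at_right t)"
proof -
  show "frequently P (at_left t)"
    unfolding frequently_def eventually_at_left[OF t(1)]
  proof safe
    fix b assume b: "b < t" "\<forall>y>b. y < t \<longrightarrow> \<not> P y"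
    show False using AE_interval_meets[OF P, of "max b 0" t] b t by auto
  qed
  show "frequently P (at_right t)"
    unfolding frequently_def eventually_at_right[OF t(2)]
  proof safe
    fix b assume b: "b > t" "\<forall>y>t. y < b \<longrightarrow> \<not> P y"
    show False using AE_interval_meets[OF P, of t "min b T"] b t by auto
  qed
qed

lemma tendsto_frequently_le:
  fixes f :: "'b \<Rightarrow> real"
  assumes "(f \<longlongrightarrow> l) F" "frequently (\<lambda>s. f s \<le> c) F"
  shows "l \<le> c"
proof (rule ccontr)
  assume "\<not> l \<le> c"
  then have "eventually (\<lambda>s. \<not> f s \<le> c) F" using order_tendstoD(1)[OF assms(1), of c] by (simp add: not_le)
  then show False using assms(2) by (simp add: frequently_def)
qed

text \<open>
  The limit \<open>w1\<close> minimizes \<open>v \<mapsto> H1 v\<close> over \<open>U\<close>, and \<open>w2\<close> minimizes \<open>v \<mapsto> H2 v\<close>. Comparing each with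
  the values of \<open>w\<close> on the other side of \<open>t\<close> gives \<open>H1 (w1 - w2) \<le> 0\<close> and \<open>H2 (w2 - w1) \<le> 0\<close>; add the
  two. Both comparisons are made with values of \<open>w\<close>, which lie in \<open>U\<close>, before passing to the limit,
  which need not lie in \<open>U\<close>.
\<close>
lemma minimizer_jump_sign:
  fixes H w :: "real \<Rightarrow> real"
  assumes t: "0 < t" "t < T"
    and min: "AE s in lebesgue_on {0<..<T}. U (w s) \<and> (\<forall>v. U v \<longrightarrow> H s * w s \<le> H s * v)"
    and H: "(H \<longlongrightarrow> H1) (at_left t)" "(H \<longlongrightarrow> H2) (at_right t)"
    and w: "(w \<longlongrightarrow> w1) (at_left t)" "(w \<longlongrightarrow> w2) (at_right t)"
  shows "(w2 - w1) * (H2 - H1) \<le> 0"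
proof -
  note freq = AE_frequently_one_sided[OF min t]
  have left: "H1 * (w1 - v) \<le> 0" if "U v" for v
  proof (rule tendsto_frequently_le)
    show "((\<lambda>s. H s * (w s - v)) \<longlongrightarrow> H1 * (w1 - v)) (at_left t)" by (intro tendsto_intros H w)
    show "frequently (\<lambda>s. H s * (w s - v) \<le> 0) (at_left t)"
      using freq(1) by (rule frequently_elim1) (use that in \<open>auto simp: algebra_simps\<close>)
  qed
  have right: "H2 * (w2 - v) \<le> 0" if "U v" for v
  proof (rule tendsto_frequently_le)
    show "((\<lambda>s. H s * (w s - v)) \<longlongrightarrow> H2 * (w2 - v)) (at_right t)" by (intro tendsto_intros H w)
    show "frequently (\<lambda>s. H s * (w s - v) \<le> 0) (at_right t)"
      using freq(2) by (rule frequently_elim1) (use that in \<open>auto simp: algebra_simps\<close>)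
  qed
  have "H1 * (w1 - w2) \<le> 0"
  proof (rule tendsto_frequently_le)
    show "((\<lambda>s. H1 * (w1 - w s)) \<longlongrightarrow> H1 * (w1 - w2)) (at_right t)" by (intro tendsto_intros w)
    show "frequently (\<lambda>s. H1 * (w1 - w s) \<le> 0) (at_right t)"
      using freq(2) by (rule frequently_elim1) (use left in blast)
  qed
  moreover have "H2 * (w2 - w1) \<le> 0"
  proof (rule tendsto_frequently_le)
    show "((\<lambda>s. H2 * (w2 - w s)) \<longlongrightarrow> H2 * (w2 - w1)) (at_left t)" by (intro tendsto_intros w)
    show "frequently (\<lambda>s. H2 * (w2 - w s) \<le> 0) (at_left t)"
      using freq(1) by (rule frequently_elim1) (use right in blast)
  qed
  ultimately show ?thesis by (simp add: algebra_simps)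
qed

section \<open>Integrability in the adjoint equation\<close>

lemma C2_imp_C1:
  fixes h :: "'a::real_normed_vector \<Rightarrow> 'b::real_normed_vector"
  assumes "C2 h"
  obtains h' :: "'a \<Rightarrow> 'a \<Rightarrow>\<^sub>L 'b"
  where "\<And>z. (h has_derivative blinfun_apply (h' z)) (at z)" "continuous_on UNIV h'"
proof -
  obtain h' :: "'a \<Rightarrow> 'a \<Rightarrow>\<^sub>L 'b" and h'' :: "'a \<Rightarrow> 'a \<Rightarrow>\<^sub>L ('a \<Rightarrow>\<^sub>L 'b)"
    where h: "\<And>z. (h has_derivative blinfun_apply (h' z)) (at z)"
      and h': "\<And>z. (h' has_derivative blinfun_apply (h'' z)) (at z)"
    using assms unfolding C2_def by blast
  have "continuous_on UNIV h'" by (rule has_derivative_continuous_on) (use h' in blast)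
  with h show ?thesis by (rule that)
qed

lemma gradient_eq:
  fixes h :: "real^'n \<Rightarrow> real"
  assumes "(h has_derivative h') (at z)"
  shows "gradient h z = (\<Sum>j\<in>UNIV. h' (axis j 1) *\<^sub>R axis j 1)" "h' v = gradient h z \<bullet> v"
proof -
  have eq: "frechet_derivative h (at z) = h'" using assms frechet_derivative_at by metis
  have lin: "linear h'" using assms has_derivative_linear by blast
  show *: "gradient h z = (\<Sum>j\<in>UNIV. h' (axis j 1) *\<^sub>R axis j 1)"
    unfolding gradient_def eq by (simp add: vec_eq_iff axis_def if_distrib cong: if_cong)
  have "h' v = h' (\<Sum>j\<in>UNIV. (v $ j) *\<^sub>R axis j 1)"
    by (simp add: basis_expansion[of v, unfolded scalar_mult_eq_scaleR])
  also have "\<dots> = (\<Sum>j\<in>UNIV. (v $ j) * h' (axis j 1))"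
    by (simp add: linear_sum[OF lin] linear_scale[OF lin])
  also have "\<dots> = gradient h z \<bullet> v"
    unfolding gradient_def eq inner_vec_def by (simp add: mult.commute)
  finally show "h' v = gradient h z \<bullet> v" .
qed

lemma covector_times_jacobian:
  fixes h :: "real^'n \<Rightarrow> real^'n"
  assumes "(h has_derivative h') (at z)"
  shows "q v* jacobian h (at z) = (\<Sum>j\<in>UNIV. (h' (axis j 1) \<bullet> q) *\<^sub>R axis j 1)"
proof -
  have eq: "frechet_derivative h (at z) = h'" using assms frechet_derivative_at by metis
  show ?thesis
    unfolding jacobian_def eq
    by (simp add: vec_eq_iff axis_def if_distrib vector_matrix_mult_def matrix_def inner_vec_def
        mult.commute cong: if_cong)
qed

text \<open>
  The integral of a function that is not integrable is 0 by convention, so the adjoint equation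
  determines the jumps of \<open>p\<close> only once integrability is known. All the factors are measurable and
  bounded almost everywhere on the open interval, and the two end points form a null set.
\<close>
lemma adjoint_integrand_integrable:
  fixes f0 f1 :: "real^'n \<Rightarrow> real^'n" and x p :: "real \<Rightarrow> real^'n"
  assumes f: "C2 f0" "C2 f1" and x: "continuous_on {0..T} x" and u: "u \<in> Linf T"
    and p: "bounded_variation T p"
  shows "set_integrable lebesgue {0..T} (\<lambda>s. p s v* jacobian (\<lambda>y. f0 y + u s *\<^sub>R f1 y) (at (x s)))"
proof -
  obtain D0 where D0: "\<And>z. (f0 has_derivative blinfun_apply (D0 z)) (at z)" "continuous_on UNIV D0"
    using C2_imp_C1[OF f(1)] by blast
  obtain D1 where D1: "\<And>z. (f1 has_derivative blinfun_apply (D1 z)) (at z)" "continuous_on UNIV D1"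
    using C2_imp_C1[OF f(2)] by blast
  define A where "A j s = blinfun_apply (D0 (x s)) (axis j 1)" for j and s :: real
  define B where "B j s = blinfun_apply (D1 (x s)) (axis j 1)" for j and s :: real
  define K where "K s = (\<Sum>j\<in>UNIV. ((A j s + u s *\<^sub>R B j s) \<bullet> p s) *\<^sub>R axis j (1::real))" for s
  have K: "p s v* jacobian (\<lambda>y. f0 y + u s *\<^sub>R f1 y) (at (x s)) = K s" for s
    unfolding K_def A_def B_def
    by (rule covector_times_jacobian) (intro derivative_intros D0 D1)
  have cont: "continuous_on {0..T} (A j)" "continuous_on {0..T} (B j)" for j
    unfolding A_def B_def
    by (intro continuous_intros continuous_on_compose2[OF D0(2) x] continuous_on_compose2[OF D1(2) x]; simp)+
  let ?M = "lebesgue_on {0<..<T}"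
  obtain c where um: "u \<in> borel_measurable ?M" and uc: "AE s in ?M. norm (u s) \<le> c"
    using u unfolding Linf_def by blast
  have pm: "p \<in> borel_measurable ?M" by (rule bounded_variation_measurable[OF p])
  obtain P where P: "\<And>s. s \<in> {0..T} \<Longrightarrow> norm (p s) \<le> P" using bounded_variation_bounded[OF p] by blast
  have entry: "integrable ?M (\<lambda>s. ((A j s + u s *\<^sub>R B j s) \<bullet> p s) *\<^sub>R axis j (1::real))" for j
  proof -
    obtain a where a: "\<And>s. s \<in> {0..T} \<Longrightarrow> norm (A j s) \<le> a"
      using compact_image_norm_bound[OF compact_Icc cont(1)] by blast
    obtain b where b: "\<And>s. s \<in> {0..T} \<Longrightarrow> norm (B j s) \<le> b"
      using compact_image_norm_bound[OF compact_Icc cont(2)] by blast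
    have "A j \<in> borel_measurable ?M" "B j \<in> borel_measurable ?M"
      using continuous_on_interval_integrable[OF cont(1)] continuous_on_interval_integrable[OF cont(2)]
      by (auto intro: borel_measurable_integrable)
    then have meas: "(\<lambda>s. ((A j s + u s *\<^sub>R B j s) \<bullet> p s) *\<^sub>R axis j (1::real)) \<in> borel_measurable ?M"
      using um pm by (intro borel_measurable_scaleR borel_measurable_inner borel_measurable_add) auto
    have fin: "finite_measure ?M" by (rule finite_measure_lebesgue_on) simp
    have mem: "AE s in ?M. s \<in> {0..T}" by (rule AE_I2) auto
    have "AE s in ?M. norm (((A j s + u s *\<^sub>R B j s) \<bullet> p s) *\<^sub>R axis j (1::real)) \<le> (a + c * b) * P"
      using uc mem
    proof eventually_elim
      case (elim s)
      have "norm (A j s + u s *\<^sub>R B j s) \<le> norm (A j s) + norm (u s) * norm (B j s)"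
        using norm_triangle_ineq[of "A j s" "u s *\<^sub>R B j s"] by simp
      also have "\<dots> \<le> a + c * b"
        using elim a b by (intro add_mono mult_mono) (auto intro: order_trans[OF norm_ge_zero])
      finally have "norm (A j s + u s *\<^sub>R B j s) * norm (p s) \<le> (a + c * b) * P"
        using P[OF elim(2)] by (intro mult_mono) (auto intro: order_trans[OF norm_ge_zero])
      then show ?case
        using Cauchy_Schwarz_ineq2[of "A j s + u s *\<^sub>R B j s" "p s"] by (simp add: norm_axis_1)
    qed
    then show ?thesis by (rule finite_measure.integrable_const_bound[OF fin _ meas])
  qed
  have "integrable ?M K" unfolding K_def by (intro Bochner_Integration.integrable_sum entry)
  then have "K absolutely_integrable_on {0<..<T}"
    by (simp add: set_integrable_def integrable_restrict_space)
  then have "K absolutely_integrable_on {0..T}"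
    by (rule absolutely_integrable_spike_set) (rule negligible_subset[of "{0, T}"], auto)+
  then show ?thesis unfolding K .
qed

section \<open>Jumps of the multipliers\<close>

lemma nonneg_Radon_props:
  assumes "m \<in> nonneg_Radon T"
  shows "finite_measure m" "space m = {0..T}" "sets m = sets (restrict_space borel {0..T})"
    "\<And>a b. 0 \<le> a \<Longrightarrow> b \<le> T \<Longrightarrow> {a..b} \<in> sets m"
proof -
  show fin: "finite_measure m" and sets: "sets m = sets (restrict_space borel {0..T})"
    using assms by (auto simp: nonneg_Radon_def)
  show "space m = {0..T}" using sets_eq_imp_space_eq[OF sets] by (simp add: space_restrict_space)
  show "{a..b} \<in> sets m" if "0 \<le> a" "b \<le> T" for a b
    unfolding sets using that by (subst sets_restrict_space_iff) auto
qed

lemma nonneg_Radon_integrable: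
  fixes f :: "real \<Rightarrow> 'a::euclidean_space"
  assumes m: "m \<in> nonneg_Radon T" and f: "continuous_on {0..T} f"
  shows "integrable m f"
proof -
  obtain B where B: "\<And>s. s \<in> {0..T} \<Longrightarrow> norm (f s) \<le> B"
    using compact_image_norm_bound[OF compact_Icc f] by blast
  have "f \<in> borel_measurable (restrict_space borel {0..T})"
    by (rule borel_measurable_continuous_on_restrict[OF f])
  then have meas: "f \<in> borel_measurable m"
    using measurable_cong_sets[OF nonneg_Radon_props(3)[OF m] refl] by blast
  have "AE s in m. norm (f s) \<le> B" using B nonneg_Radon_props(2)[OF m] by (intro AE_I2) auto
  then show ?thesis
    by (rule finite_measure.integrable_const_bound[OF nonneg_Radon_props(1)[OF m] _ meas])
qed

lemma nonneg_Radon_left_limit: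
  fixes f :: "real \<Rightarrow> 'a::euclidean_space"
  assumes m: "m \<in> nonneg_Radon T" and f: "continuous_on {0..T} f" and t: "0 < t" "t < T"
  shows "((\<lambda>s. LINT r:{0..s}|m. f r) \<longlongrightarrow> (LINT r:{0..t}|m. f r) - measure m {t} *\<^sub>R f t) (at_left t)"
proof (rule set_integral_left_limit[OF _ t])
  show "set_integrable m {0..T} f"
    unfolding set_integrable_def
    by (rule integrable_mult_indicator[OF _ nonneg_Radon_integrable[OF m f]])
       (use nonneg_Radon_props(4)[OF m] in auto)
  show "{0..s} \<in> sets m" if "0 \<le> s" "s \<le> T" for s using nonneg_Radon_props(4)[OF m] that by auto
  show "{t} \<in> sets m" using nonneg_Radon_props(4)[OF m, of t t] t by auto
  show "emeasure m {t} < \<infinity>"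
    using finite_measure.emeasure_finite[OF nonneg_Radon_props(1)[OF m]] by (simp add: top.not_eq_extremum)
qed

lemma distribution_function_jump:
  assumes m: "m \<in> nonneg_Radon T" and \<mu>: "has_bv_derivative T \<mu> (measure m)" and t: "0 < t" "t < T"
  shows "has_jump \<mu> t (measure m {t})"
proof -
  have eq: "(LINT r:{0..s}|m. (1::real)) = measure m {0..s}" if "s \<le> T" for s
  proof -
    have "{0..s} \<in> sets m" using nonneg_Radon_props(4)[OF m] that by auto
    moreover have "emeasure m {0..s} < \<infinity>"
      using finite_measure.emeasure_finite[OF nonneg_Radon_props(1)[OF m]] by (simp add: top.not_eq_extremum)
    ultimately show ?thesis by (simp add: set_lebesgue_integral_def)
  qed
  have "((\<lambda>s. LINT r:{0..s}|m. (1::real)) \<longlongrightarrow> measure m {0..t} - measure m {t}) (at_left t)"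
    using nonneg_Radon_left_limit[OF m, of "\<lambda>_. 1::real", OF _ t] eq[of t] t by simp
  moreover have "eventually (\<lambda>s. s \<in> {0<..<t}) (at_left t)"
    by (rule eventually_at_leftI[of 0]) (use t in auto)
  then have "eventually (\<lambda>s. (LINT r:{0..s}|m. (1::real)) = measure m {0..s}) (at_left t)"
    by eventually_elim (use eq t in auto)
  ultimately have "((\<lambda>s. measure m {0..s}) \<longlongrightarrow> measure m {0..t} - measure m {t}) (at_left t)"
    by (rule Lim_transform_eventually)
  from bv_derivative_jump[OF \<mu> t this] show ?thesis by simp
qed

text \<open>
  Lebesgue measure has no atoms, so only the measure \<open>m\<close> contributes to the jump.
\<close>
lemma costate_jump:
  fixes p K G :: "real \<Rightarrow> 'a::euclidean_space"
  assumes m: "m \<in> nonneg_Radon T"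
    and p: "has_bv_derivative T p (\<lambda>A. - ((LINT s:A|lebesgue. K s) + (LINT s:A|m. G s)))"
    and K: "set_integrable lebesgue {0..T} K" and G: "continuous_on {0..T} G"
    and t: "0 < t" "t < T"
  shows "has_jump p t (- (measure m {t} *\<^sub>R G t))"
proof -
  have "((\<lambda>s. LINT r:{0..s}|lebesgue. K r) \<longlongrightarrow> (LINT r:{0..t}|lebesgue. K r)) (at_left t)"
    using set_integral_left_limit[OF K t] by simp
  from tendsto_minus[OF tendsto_add[OF this nonneg_Radon_left_limit[OF m G t]]]
  have "((\<lambda>s. - ((LINT r:{0..s}|lebesgue. K r) + (LINT r:{0..s}|m. G r))) \<longlongrightarrow>
      - ((LINT r:{0..t}|lebesgue. K r) + ((LINT r:{0..t}|m. G r) - measure m {t} *\<^sub>R G t))) (at_left t)"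
    .
  from bv_derivative_jump[OF p t this] show ?thesis by (simp add: algebra_simps)
qed

text \<open>
  A nonpositive function with integral 0 vanishes almost everywhere, and a point of positive mass is
  not contained in a null set.
\<close>
lemma atom_imp_active:
  fixes y :: "real \<Rightarrow> real"
  assumes m: "m \<in> nonneg_Radon T" and y: "continuous_on {0..T} y" "\<And>s. s \<in> {0..T} \<Longrightarrow> y s \<le> 0"
    and int: "(LINT s|m. y s) = 0" and t: "t \<in> {0..T}" and atom: "measure m {t} \<noteq> 0"
  shows "y t = 0"
proof -
  note props = nonneg_Radon_props[OF m]
  have "AE s in m. 0 \<le> - y s" using y(2) props(2) by (intro AE_I2) auto
  moreover have "integrable m (\<lambda>s. - y s)"
    using nonneg_Radon_integrable[OF m y(1)] by (rule Bochner_Integration.integrable_minus)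
  moreover have "(LINT s|m. - y s) = 0" using int by simp
  ultimately have "AE s in m. - y s = 0"
    using integral_nonneg_eq_0_iff_AE[of m "\<lambda>s. - y s"] by blast
  then have "AE s in m. s \<notin> {t}" if "y t \<noteq> 0"
    by eventually_elim (use that in auto)
  then have "{t} \<in> null_sets m" if "y t \<noteq> 0"
    using AE_iff_null_sets[of "{t}" m] props(4)[of t t] t that by simp
  then show "y t = 0" using atom measure_eq_0_null_sets by blast
qed

section \<open>Complementarity of the jumps\<close>

theorem lemma2p5:
  fixes T t ju \<beta> :: real and n1 n2 :: nat and umin umax :: ereal
    and f0 f1 :: "real^'n \<Rightarrow> real^'n"
    and \<phi> :: "(real^'n) \<times> (real^'n) \<Rightarrow> real"
    and g :: "real^'n \<Rightarrow> real"
    and \<Phi> :: "(real^'n) \<times> (real^'n) \<Rightarrow> nat \<Rightarrow> real"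
    and u :: "real \<Rightarrow> real" and x p :: "real \<Rightarrow> real^'n"
    and \<Psi> :: "nat \<Rightarrow> real" and d\<mu> :: "real measure" and \<mu> :: "real \<Rightarrow> real"
  assumes "0 < T"
    and "C2 f0" and "\<exists>L. L-lipschitz_on UNIV f0"
    and "C2 f1" and "\<exists>L. L-lipschitz_on UNIV f1"
    and "C2 \<phi>" and "C2 g" and "\<forall>i\<in>{1..n1+n2}. C2 (\<lambda>w. \<Phi> w i)"
    and "umin \<noteq> \<infinity>" and "umax \<noteq> -\<infinity>"
    and "feasible T f0 f1 g \<Phi> n1 n2 umin umax u x"
    and "(\<beta>, \<Psi>, p, d\<mu>) \<in> Lambda T f0 f1 \<phi> g \<Phi> n1 n2 umin umax u x"
    and "has_bv_derivative T \<mu> (measure d\<mu>)" and "\<mu> T = 0"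
    and "t \<in> {0<..<T}"
    and "has_ae_jump T u t ju"
  shows "(\<exists>jH. has_jump (H_u f1 x p) t jH \<and> ju * jH = 0) \<and>
         (\<exists>j\<mu> jg. has_jump \<mu> t j\<mu> \<and> has_ae_jump T (ddt T (\<lambda>s. g (x s))) t jg \<and> j\<mu> * jg = 0)"
proof -
  let ?M = "lebesgue_on {0<..<T}"
  have t: "0 < t" "t < T" using assms by auto
  have u: "u \<in> Linf T" and x: "x \<in> W1inf T"
    and ode: "AE s in ?M. ddt T x s = f0 (x s) + u s *\<^sub>R f1 (x s)"
    and ubounds: "AE s in ?M. umin \<le> ereal (u s) \<and> ereal (u s) \<le> umax"
    and gx: "\<And>s. s \<in> {0..T} \<Longrightarrow> g (x s) \<le> 0"
    using assms(11) unfolding feasible_def by auto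
  have m: "d\<mu> \<in> nonneg_Radon T" and compl: "(LINT s|d\<mu>. g (x s)) = 0"
    and p: "has_bv_derivative T p (\<lambda>A. - ((LINT s:A|lebesgue. p s v* jacobian (\<lambda>y. f0 y + u s *\<^sub>R f1 y) (at (x s)))
        + (LINT s:A|d\<mu>. gradient g (x s))))"
    and minH: "AE s in ?M.
        (umin \<noteq> -\<infinity> \<and> H_u f1 x p s > 0 \<longrightarrow> ereal (u s) = umin) \<and>
        (umax \<noteq> \<infinity> \<and> H_u f1 x p s < 0 \<longrightarrow> ereal (u s) = umax) \<and>
        (umin < ereal (u s) \<and> ereal (u s) < umax \<longrightarrow> H_u f1 x p s = 0) \<and>
        (umin = -\<infinity> \<longrightarrow> H_u f1 x p s \<le> 0) \<and>
        (umax = \<infinity> \<longrightarrow> H_u f1 x p s \<ge> 0)"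
    using assms(12) unfolding Lambda_def by auto
  obtain w l r where w: "AE s in ?M. w s = u s"
    and wlim: "(w \<longlongrightarrow> l) (at_left t)" "(w \<longlongrightarrow> r) (at_right t)" and ju: "ju = r - l"
    using assms(16) unfolding has_ae_jump_def has_jump_def by blast
  obtain g' where g': "\<And>z. (g has_derivative blinfun_apply (g' z)) (at z)" "continuous_on UNIV g'"
    using C2_imp_C1[OF \<open>C2 g\<close>] by blast
  obtain f0' where f0': "\<And>z. (f0 has_derivative blinfun_apply (f0' z)) (at z)"
    using C2_imp_C1[OF \<open>C2 f0\<close>] by blast
  obtain f1' where f1': "\<And>z. (f1 has_derivative blinfun_apply (f1' z)) (at z)"
    using C2_imp_C1[OF \<open>C2 f1\<close>] by blast

  have contx: "continuous_on {0..T} x" using x by (simp add: W1inf_def)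
  have "isCont x t"
    by (rule continuous_on_interior[OF contx]) (use t in \<open>simp add: interior_atLeastAtMost_real\<close>)
  then have xlim: "(x \<longlongrightarrow> x t) (at_left t)" "(x \<longlongrightarrow> x t) (at_right t)"
    unfolding isCont_def using tendsto_within_subset by blast+
  have gxcont: "continuous_on {0..T} (\<lambda>s. g (x s))"
    by (rule continuous_on_compose2[OF _ contx, of UNIV])
       (auto intro!: has_derivative_continuous_on has_derivative_at_withinI[OF g'(1)])
  have gradcont: "continuous_on {0..T} (\<lambda>s. gradient g (x s))"
    unfolding gradient_eq(1)[OF g'(1)]
    by (intro continuous_intros continuous_on_compose2[OF g'(2) contx]) auto
  note Dg = gradient_eq(2)[OF g'(1)]

  define atom where "atom = measure d\<mu> {t}"
  define a where "a = gradient g (x t) \<bullet> f1 (x t)"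
  have atom_nonneg: "0 \<le> atom" by (simp add: atom_def)
  have jump_\<mu>: "has_jump \<mu> t atom"
    unfolding atom_def by (rule distribution_function_jump[OF m assms(13) t])
  have "has_jump p t (- (atom *\<^sub>R gradient g (x t)))"
    unfolding atom_def
    by (rule costate_jump[OF m p adjoint_integrand_integrable gradcont t])
       (use assms contx u p in \<open>auto simp: has_bv_derivative_def\<close>)
  then obtain pl pr where plim: "(p \<longlongrightarrow> pl) (at_left t)" "(p \<longlongrightarrow> pr) (at_right t)"
    and jump_p: "pr - pl = - (atom *\<^sub>R gradient g (x t))"
    unfolding has_jump_def by metis

  have "isCont f0 z" "isCont f1 z" "isCont g' z" for z
    using f0' f1' g'(2) has_derivative_continuous continuous_on_eq_continuous_at[OF open_UNIV] by blast+
  then have lim: "((\<lambda>s. f0 (x s)) \<longlongrightarrow> f0 (x t)) F" "((\<lambda>s. f1 (x s)) \<longlongrightarrow> f1 (x t)) F"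
    "((\<lambda>s. g' (x s)) \<longlongrightarrow> g' (x t)) F" if "(x \<longlongrightarrow> x t) F" for F
    using isCont_tendsto_compose[OF _ that] by blast+

  have Hlim: "(H_u f1 x p \<longlongrightarrow> pl \<bullet> f1 (x t)) (at_left t)" "(H_u f1 x p \<longlongrightarrow> pr \<bullet> f1 (x t)) (at_right t)"
    unfolding H_u_def[abs_def] by (intro tendsto_intros plim lim xlim)+
  define jH where "jH = pr \<bullet> f1 (x t) - pl \<bullet> f1 (x t)"
  have jump_H: "has_jump (H_u f1 x p) t jH"
    unfolding has_jump_def jH_def using Hlim by blast
  have jH: "jH = - (atom * a)"
    unfolding jH_def a_def by (simp flip: inner_diff_left add: jump_p)

  \<comment> \<open>The representative of the derivative of \<open>g(x)\<close> obtained from the one of \<open>u\<close>.\<close>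
  define W where "W s = blinfun_apply (g' (x s)) (f0 (x s) + w s *\<^sub>R f1 (x s))" for s
  define Wl where "Wl = blinfun_apply (g' (x t)) (f0 (x t) + l *\<^sub>R f1 (x t))"
  define Wr where "Wr = blinfun_apply (g' (x t)) (f0 (x t) + r *\<^sub>R f1 (x t))"
  note W1 = W1inf_compose[OF \<open>0 < T\<close> x g']
  have W: "AE s in ?M. ddt T (\<lambda>s. g (x s)) s = W s"
    using W1(2) ode w by eventually_elim (simp add: W_def)
  have Wlim: "(W \<longlongrightarrow> Wl) (at_left t)" "(W \<longlongrightarrow> Wr) (at_right t)"
    unfolding W_def[abs_def] Wl_def Wr_def by (intro tendsto_intros lim xlim wlim)+
  define jg where "jg = Wr - Wl"
  have "AE s in ?M. W s = ddt T (\<lambda>s. g (x s)) s" using W by eventually_elim simp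
  then have jump_g: "has_ae_jump T (ddt T (\<lambda>s. g (x s))) t jg"
    unfolding has_ae_jump_def has_jump_def jg_def using Wlim by blast
  have jg: "jg = ju * a"
    unfolding jg_def Wl_def Wr_def ju a_def Dg by (simp add: inner_simps algebra_simps)

  have "AE s in ?M. (umin \<le> ereal (w s) \<and> ereal (w s) \<le> umax) \<and>
      (\<forall>v. umin \<le> ereal v \<and> ereal v \<le> umax \<longrightarrow> H_u f1 x p s * w s \<le> H_u f1 x p s * v)"
    using w ubounds minH
  proof eventually_elim
    case (elim s)
    have "H_u f1 x p s * w s \<le> H_u f1 x p s * v" if v: "umin \<le> ereal v" "ereal v \<le> umax" for v
    proof (cases "H_u f1 x p s" "0::real" rule: linorder_cases)
      case less
      then have "umax \<noteq> \<infinity>" using elim(3) by (meson not_le)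
      then have "ereal (u s) = umax" using elim(3) less by blast
      then have "v \<le> w s" using v(2) unfolding elim(1) by (metis ereal_less_eq(3))
      then show ?thesis using less by (simp add: mult_left_mono_neg)
    next
      case greater
      then have "umin \<noteq> -\<infinity>" using elim(3) by (meson not_le)
      then have "ereal (u s) = umin" using elim(3) greater by blast
      then have "w s \<le> v" using v(1) unfolding elim(1) by (metis ereal_less_eq(3))
      then show ?thesis using greater by simp
    qed simp
    then show ?case using elim(2) unfolding elim(1) by blast
  qed
  from minimizer_jump_sign[OF t this Hlim wlim] have upper: "ju * jH \<le> 0" unfolding ju jH_def .

  have "atom * jg = 0"
  proof (cases "atom = 0")
    case False
    have "g (x t) = 0"
      by (rule atom_imp_active[OF m gxcont gx compl]) (use t False in \<open>auto simp: atom_def\<close>)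
    then have max: "\<And>s. s \<in> {0..T} \<Longrightarrow> g (x s) \<le> g (x t)" using gx by simp
    have "0 \<le> Wl" by (rule max_one_sided_derivatives(1)[OF W1(1) t W max Wlim(1)])
    moreover have "Wr \<le> 0" by (rule max_one_sided_derivatives(2)[OF W1(1) t W max Wlim(2)])
    ultimately have "jg \<le> 0" by (simp add: jg_def)
    then have "atom * jg \<le> 0" using atom_nonneg by (rule mult_nonneg_nonpos[rotated])
    moreover have "ju * jH = - (atom * jg)" unfolding jg jH by simp
    ultimately show ?thesis using upper by linarith
  qed simp
  moreover have "ju * jH = - (atom * jg)" unfolding jg jH by simp
  ultimately have "ju * jH = 0" "atom * jg = 0" by auto
  then show ?thesis using jump_H jump_\<mu> jump_g by blast
qed

end
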